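(* Let $$X:=\{x_1x_2=x_3x_4+x_5^2\}\subset\mathbb{P}^4$$ and let $G=\mathfrak{D}_{4n}$ with $n$ odd, acting on $X$ via faithful $2$-dimensional representations on $\{x_1,x_2\}$ and on $\{x_3,x_4\}$, and trivially on $x_5$. Then the $G$-action on $X$ is stably linearizable.
   Context: The base field $k$ is algebraically closed of characteristic zero. $\mathfrak{D}_{m}$ denotes the dihedral group of order $2m$. The linear action of $G$ on $k^5$ preserves the quadratic form $x_1x_2-x_3x_4-x_5^2$; the faithful $2$-dimensional representations are in the standard form in which an involution $\tau$ acts by $x_1\leftrightarrow x_2$, $x_3\leftrightarrow x_4$, and the rotation generator $\sigma$ acts on $x_1,x_2$ by $\zeta,\zeta^{-1}$ and on $x_3,x_4$ by $\zeta',\zeta'^{-1}$, where $\zeta,\zeta'$ are primitive $4n$-th roots of unity. For a finite group $G$, a smooth variety $X$ over $k$ with a generically free regular action of $G$ is called linearizable if there is a $G$-equivariant birational map $\mathbb{P}(V)\dashrightarrow X$ for some linear representation $V$ of $G$. It is called stably linearizable if $X\times\mathbb{P}^m$, with trivial action on the second factor, is linearizable for some $m$. *)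

theory Defs
  imports
    "HOL-Analysis.Abstract_Topology"
    "HOL-Library.Poly_Mapping"
    "HOL-Computational_Algebra.Polynomial"
    "Jordan_Normal_Form.Matrix"
begin

section \<open>Products of projective spaces\<close>

text \<open>The point of projective space with homogeneous coordinates \<open>v\<close> is the set of all
  homogeneous coordinate vectors that represent it.\<close>

definition proj_pt :: "'k::field vec \<Rightarrow> 'k vec set" where
  "proj_pt v = {c \<cdot>\<^sub>v v | c. c \<noteq> 0}"

definition proj_space :: "nat \<Rightarrow> 'k::field vec set set" where
  "proj_space N = proj_pt ` (carrier_vec (Suc N) - {0\<^sub>v (Suc N)})"

text \<open>\<open>mproj [d\<^sub>0, \<dots>, d\<^sub>r]\<close> is the product of the projective spaces of dimensions
  \<open>d\<^sub>0, \<dots>, d\<^sub>r\<close>, a point being the list of its components. For a point \<open>p\<close>, the lists in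
  \<open>listset p\<close> are exactly the possible choices of homogeneous coordinates of all components.\<close>

definition mproj :: "nat list \<Rightarrow> 'k::field vec set list set" where
  "mproj ds = listset (map proj_space ds)"

text \<open>Multivariate polynomials; the variable \<open>(i, j)\<close> is the \<open>j\<close>-th homogeneous coordinate on
  the \<open>i\<close>-th factor.\<close>

type_synonym 'k mpoly = "(nat \<times> nat \<Rightarrow>\<^sub>0 nat) \<Rightarrow>\<^sub>0 'k"

definition eval_mpoly :: "'k::field vec list \<Rightarrow> 'k mpoly \<Rightarrow> 'k" where
  "eval_mpoly vs F =
     (\<Sum>m\<in>Poly_Mapping.keys F. Poly_Mapping.lookup F m *
        (\<Prod>x\<in>Poly_Mapping.keys m. ((vs ! fst x) $ snd x) ^ Poly_Mapping.lookup m x))"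

definition multihomogeneous :: "nat list \<Rightarrow> (nat \<Rightarrow> nat) \<Rightarrow> 'k::field mpoly \<Rightarrow> bool" where
  "multihomogeneous ds d F \<longleftrightarrow>
     (\<forall>m\<in>Poly_Mapping.keys F.
        (\<forall>x\<in>Poly_Mapping.keys m. fst x < length ds \<and> snd x \<le> ds ! fst x) \<and>
        (\<forall>i<length ds. (\<Sum>j\<le>ds ! i. Poly_Mapping.lookup m (i, j)) = d i))"

definition basic_open :: "nat list \<Rightarrow> 'k::field mpoly \<Rightarrow> 'k vec set list set" where
  "basic_open ds F = {p \<in> mproj ds. \<forall>vs\<in>listset p. eval_mpoly vs F \<noteq> 0}"

definition zariski :: "nat list \<Rightarrow> 'k::field vec set list topology" where
  "zariski ds = topology_generated_by {basic_open ds F | F d. multihomogeneous ds d F}"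

definition dense_open :: "nat list \<Rightarrow> 'k::field vec set list set \<Rightarrow> 'k vec set list set \<Rightarrow> bool" where
  "dense_open ds X U \<longleftrightarrow>
     openin (subtopology (zariski ds) X) U \<and> subtopology (zariski ds) X closure_of U = X"


section \<open>Regular maps and equivariant birational maps\<close>

text \<open>\<open>given_by ds es \<Phi> W f\<close>: on \<open>W\<close>, the \<open>i\<close>-th component of \<open>f\<close> has the homogeneous coordinates
  \<open>\<Phi> i 0 : \<dots> : \<Phi> i (es ! i)\<close>, multihomogeneous polynomials of equal multidegree without
  common zeros on \<open>W\<close>.\<close>

definition given_by ::
  "nat list \<Rightarrow> nat list \<Rightarrow> (nat \<Rightarrow> nat \<Rightarrow> 'k::field mpoly) \<Rightarrow> 'k vec set list set \<Rightarrow>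
   ('k vec set list \<Rightarrow> 'k vec set list) \<Rightarrow> bool" where
  "given_by ds es \<Phi> W f \<longleftrightarrow>
     (\<forall>i<length es. \<exists>d. \<forall>j\<le>es ! i. multihomogeneous ds d (\<Phi> i j)) \<and>
     (\<forall>p\<in>W. \<forall>vs\<in>listset p. \<forall>i<length es.
        (let w = Matrix.vec (Suc (es ! i)) (\<lambda>j. eval_mpoly vs (\<Phi> i j))
         in w \<noteq> 0\<^sub>v (Suc (es ! i)) \<and> f p ! i = proj_pt w))"

definition regular_map ::
  "nat list \<Rightarrow> nat list \<Rightarrow> 'k::field vec set list set \<Rightarrow>
   ('k vec set list \<Rightarrow> 'k vec set list) \<Rightarrow> bool" where
  "regular_map ds es U f \<longleftrightarrow>
     f ` U \<subseteq> mproj es \<and>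
     (\<forall>p\<in>U. \<exists>W \<Phi>. openin (subtopology (zariski ds) U) W \<and> p \<in> W \<and> given_by ds es \<Phi> W f)"

text \<open>A birational map, represented by an isomorphism \<open>f\<close> (with inverse \<open>g\<close>) between dense open
  subsets \<open>U\<close> and \<open>W\<close>. These need not be stable under the group: equality of the rational maps
  \<open>f \<circ> a\<close> and \<open>b \<circ> f\<close> is tested on the dense open set where both composites are visibly
  defined.\<close>

definition equivariantly_birational ::
  "('g, 'b) monoid_scheme \<Rightarrow>
   nat list \<Rightarrow> 'k::field vec set list set \<Rightarrow> ('g \<Rightarrow> 'k vec set list \<Rightarrow> 'k vec set list) \<Rightarrow>
   nat list \<Rightarrow> 'k vec set list set \<Rightarrow> ('g \<Rightarrow> 'k vec set list \<Rightarrow> 'k vec set list) \<Rightarrow> bool" where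
  "equivariantly_birational G ds X a es Y b \<longleftrightarrow>
     (\<exists>U W f g.
        dense_open ds X U \<and> dense_open es Y W \<and>
        regular_map ds es U f \<and> regular_map es ds W g \<and>
        f ` U \<subseteq> W \<and> g ` W \<subseteq> U \<and> (\<forall>p\<in>U. g (f p) = p) \<and> (\<forall>q\<in>W. f (g q) = q) \<and>
        (\<forall>\<gamma>\<in>carrier G. \<forall>p\<in>U. a \<gamma> p \<in> U \<longrightarrow> f (a \<gamma> p) = b \<gamma> (f p)))"


section \<open>Linear representations and linearizability\<close>

abbreviation GL :: "nat \<Rightarrow> 'k::field mat monoid" where
  "GL N \<equiv> units_of (ring_mat TYPE('k) N ())"

definition proj_action :: "('g \<Rightarrow> 'k::field mat) \<Rightarrow> 'g \<Rightarrow> 'k vec set list \<Rightarrow> 'k vec set list" where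
  "proj_action \<rho> \<gamma> p = map (\<lambda>q. mult_mat_vec (\<rho> \<gamma>) ` q) p"

text \<open>The notions below apply to a variety \<open>X\<close> in \<open>mproj ds\<close> with an action \<open>a\<close> of the group \<open>G\<close>.
  That \<open>X\<close> is smooth and irreducible and \<open>a\<close> regular and generically free is a standing assumption
  on the argument, not a part of the definition. The projectivization of a representation of
  dimension \<open>N + 1\<close> is \<open>mproj [N]\<close>.\<close>

definition linearizable ::
  "('g, 'b) monoid_scheme \<Rightarrow> nat list \<Rightarrow> 'k::field vec set list set \<Rightarrow>
   ('g \<Rightarrow> 'k vec set list \<Rightarrow> 'k vec set list) \<Rightarrow> bool" where
  "linearizable G ds X a \<longleftrightarrow>
     (\<exists>N \<rho>. \<rho> \<in> hom G (GL (Suc N)) \<and>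
        equivariantly_birational G [N] (mproj [N]) (proj_action \<rho>) ds X a)"

definition times_proj :: "'k::field vec set list set \<Rightarrow> nat \<Rightarrow> 'k vec set list set" where
  "times_proj X m = {p @ [q] | p q. p \<in> X \<and> q \<in> proj_space m}"

definition times_trivial ::
  "('g \<Rightarrow> 'k::field vec set list \<Rightarrow> 'k vec set list) \<Rightarrow> 'g \<Rightarrow> 'k vec set list \<Rightarrow> 'k vec set list" where
  "times_trivial a \<gamma> p = a \<gamma> (butlast p) @ [last p]"

definition stably_linearizable ::
  "('g, 'b) monoid_scheme \<Rightarrow> nat list \<Rightarrow> 'k::field vec set list set \<Rightarrow>
   ('g \<Rightarrow> 'k vec set list \<Rightarrow> 'k vec set list) \<Rightarrow> bool" where
  "stably_linearizable G ds X a \<longleftrightarrow>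
     (\<exists>m. linearizable G (ds @ [m]) (times_proj X m) (times_trivial a))"


section \<open>Dihedral groups and the quadric threefold\<close>

text \<open>The dihedral group of order \<open>2 * m\<close> (for \<open>m > 0\<close>): \<open>(a, s)\<close> stands for \<open>\<sigma>\<^sup>a\<close> if \<open>\<not> s\<close> and
  for \<open>\<sigma>\<^sup>a \<tau>\<close> if \<open>s\<close>, with \<open>\<tau> \<sigma> = \<sigma>\<^sup>-\<^sup>1 \<tau>\<close>.\<close>

definition dihedral :: "nat \<Rightarrow> (int \<times> bool) monoid" where
  "dihedral m = \<lparr>carrier = {0..<int m} \<times> UNIV,
     mult = (\<lambda>(a, s) (b, t). ((if s then a - b else a + b) mod int m, s \<noteq> t)),
     one = (0, False)\<rparr>"

definition rotation :: "int \<times> bool" where "rotation = (1, False)"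

definition reflection :: "int \<times> bool" where "reflection = (0, True)"

lemma group_dihedral:
  assumes "m > 0"
  shows "group (dihedral m)"
proof (rule groupI)
  fix x assume x: "x \<in> carrier (dihedral m)"
  show "\<exists>y\<in>carrier (dihedral m). y \<otimes>\<^bsub>dihedral m\<^esub> x = \<one>\<^bsub>dihedral m\<^esub>"
  proof (cases "snd x")
    case True
    with x show ?thesis by (intro bexI[of _ x]) (auto simp: dihedral_def)
  next
    case False
    with x assms show ?thesis
      by (intro bexI[of _ "((- fst x) mod int m, False)"]) (auto simp: dihedral_def mod_simps)
  qed
qed (use assms in \<open>auto simp: dihedral_def mod_simps algebra_simps\<close>)

definition primitive_root_of_unity :: "nat \<Rightarrow> 'k::field \<Rightarrow> bool" where
  "primitive_root_of_unity m z \<longleftrightarrow> z ^ m = 1 \<and> (\<forall>k. 0 < k \<and> k < m \<longrightarrow> z ^ k \<noteq> 1)"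

definition faithful_standard_rep ::
  "nat \<Rightarrow> 'k::field \<Rightarrow> (int \<times> bool \<Rightarrow> 'k mat) \<Rightarrow> bool" where
  "faithful_standard_rep m \<zeta> \<rho> \<longleftrightarrow>
     \<rho> \<in> hom (dihedral m) (GL 2) \<and> inj_on \<rho> (carrier (dihedral m)) \<and>
     \<rho> rotation = mat_of_rows_list 2 [[\<zeta>, 0], [0, inverse \<zeta>]] \<and>
     \<rho> reflection = mat_of_rows_list 2 [[0, 1], [1, 0]]"

text \<open>Coordinates are numbered from \<open>0\<close>, i.e. \<open>x\<^sub>1, \<dots>, x\<^sub>5\<close> are \<open>v $ 0, \<dots>, v $ 4\<close>.\<close>

definition quadric :: "'k::field vec set list set" where
  "quadric = {[p] | p. p \<in> proj_space 4 \<and>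
     (\<forall>v\<in>p. v $ 0 * v $ 1 = v $ 2 * v $ 3 + (v $ 4)\<^sup>2)}"

end

theory Submission
  imports Defs
begin

text \<open>Arrange the first four coordinates of the quadric in a matrix \<open>M\<close> with rows \<open>(x\<^sub>1, x\<^sub>3)\<close> and
  \<open>(x\<^sub>4, x\<^sub>2)\<close>, so that the equation becomes \<open>det M = x\<^sub>5\<^sup>2\<close>. The quotient of the two primitive roots
  of unity \<open>\<zeta>\<close> and \<open>\<zeta>'\<close> is the square of a power \<open>\<zeta>\<^sup>k\<close> (lemma \<open>half_exponent\<close>). Therefore the
  rotation acts on \<open>M\<close> by multiplication with diagonal matrices of determinant one from the left and
  from the right, and the reflection by conjugation with a permutation matrix: the space of
  all \<open>M\<close> is \<open>Hom(R, L)\<close> for two-dimensional representations \<open>R\<close> and \<open>L\<close>, where the rotation acts on \<open>R\<close>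
  by \<open>\<zeta>\<^sup>-\<^sup>k\<close> and \<open>\<zeta>\<^sup>k\<close>.

  The affine cone over the quadric is the double cover of \<open>Hom(R, L)\<close> on which \<open>det M\<close> acquires a
  square root. A vector of \<open>R\<close> allows one to change \<open>M\<close> so that its determinant becomes a square: a general
  \<open>(v, w)\<close> in \<open>R\<close> determines the decomposition of \<open>R\<close> into the lines of \<open>(v, w)\<close> and \<open>(v, - w)\<close>,
  in a way compatible with the group, and rescaling \<open>M\<close> by \<open>det M\<close> on the second line only squares its
  determinant. This yields a point of the quadric, and \<open>M\<close> is recovered from that
  point, the number \<open>det M\<close> and \<open>(v, w)\<close>. Thus \<open>Hom(R, L) \<times> R\<close> is birational to the product of the
  quadric, a line with trivial action, and \<open>R\<close>.

  It remains to trivialize the factor \<open>R\<close> over the quadric, which is an explicit instance of the no-name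
  lemma: with \<open>l = 4 n - k\<close> the vectors \<open>(x\<^sub>2\<^sup>k, x\<^sub>1\<^sup>k)\<close> and \<open>(x\<^sub>1\<^sup>l, x\<^sub>2\<^sup>l)\<close> depend equivariantly on the
  point of the quadric and form a basis of \<open>R\<close> where \<open>x\<^sub>1\<close> and \<open>x\<^sub>2\<close> have different \<open>4 n\<close>-th powers.
  The coefficients of \<open>(v, w)\<close> in this basis are invariant. Altogether the projectivization of the sum of
  \<open>Hom(R, L)\<close>, \<open>R\<close> and a trivial line is equivariantly birational to the product of the quadric
  with a projective three-space with trivial action.

  The maps \<open>from_linear\<close> and \<open>to_linear\<close> write this in homogeneous coordinates. They are mutually
  inverse on open sets by \<open>to_linear_from_linear\<close> and \<open>from_linear_to_linear\<close>, and equivariant by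
  \<open>from_linear_equivariant\<close>. The open sets are dense because any point can be joined by a polynomial
  curve inside the variety to a point of the open set (\<open>dense_open_nonvanish\<close>).\<close>

section \<open>Evaluation of multivariate polynomials\<close>

definition eval_monomial :: "'k::field vec list \<Rightarrow> (nat \<times> nat \<Rightarrow>\<^sub>0 nat) \<Rightarrow> 'k" where
  "eval_monomial vs m = (\<Prod>x\<in>Poly_Mapping.keys m. ((vs ! fst x) $ snd x) ^ Poly_Mapping.lookup m x)"

lemma eval_monomial_superset:
  assumes "finite S" "Poly_Mapping.keys m \<subseteq> S"
  shows "eval_monomial vs m = (\<Prod>x\<in>S. ((vs ! fst x) $ snd x) ^ Poly_Mapping.lookup m x)"
  unfolding eval_monomial_def using assms
  by (intro prod.mono_neutral_left) (auto simp: in_keys_iff)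

lemma eval_monomial_add: "eval_monomial vs (m + m') = eval_monomial vs m * eval_monomial vs m'"
proof -
  define S where "S = Poly_Mapping.keys m \<union> Poly_Mapping.keys m'"
  have S: "finite S" "Poly_Mapping.keys m \<subseteq> S" "Poly_Mapping.keys m' \<subseteq> S"
    "Poly_Mapping.keys (m + m') \<subseteq> S"
    using Poly_Mapping.keys_add[of m m'] by (auto simp: S_def)
  show ?thesis
    by (simp add: S eval_monomial_superset[of S] lookup_add power_add prod.distrib)
qed

lemma eval_mpoly_superset:
  assumes "finite S" "Poly_Mapping.keys F \<subseteq> S"
  shows "eval_mpoly vs F = (\<Sum>m\<in>S. Poly_Mapping.lookup F m * eval_monomial vs m)"
  unfolding eval_mpoly_def eval_monomial_def[symmetric] using assms
  by (intro sum.mono_neutral_left) (auto simp: in_keys_iff)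

lemma eval_mpoly_add: "eval_mpoly vs (F + G) = eval_mpoly vs F + eval_mpoly vs G"
proof -
  define S where "S = Poly_Mapping.keys F \<union> Poly_Mapping.keys G"
  have S: "finite S" "Poly_Mapping.keys F \<subseteq> S" "Poly_Mapping.keys G \<subseteq> S"
    "Poly_Mapping.keys (F + G) \<subseteq> S"
    using Poly_Mapping.keys_add[of F G] by (auto simp: S_def)
  show ?thesis
    by (simp add: S eval_mpoly_superset[of S] lookup_add distrib_right sum.distrib)
qed

lemma eval_mpoly_zero: "eval_mpoly vs 0 = 0"
  by (simp add: eval_mpoly_def)

lemma eval_mpoly_sum: "eval_mpoly vs (\<Sum>x\<in>S. F x) = (\<Sum>x\<in>S. eval_mpoly vs (F x))"
  by (induction S rule: infinite_finite_induct) (auto simp: eval_mpoly_zero eval_mpoly_add)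

lemma eval_mpoly_single: "eval_mpoly vs (Poly_Mapping.single m c) = c * eval_monomial vs m"
  by (subst eval_mpoly_superset[of "{m}"]) auto

lemma mpoly_eq_sum_single:
  "F = (\<Sum>m\<in>Poly_Mapping.keys F. Poly_Mapping.single m (Poly_Mapping.lookup F m))"
proof (rule poly_mapping_eqI)
  fix m
  show "Poly_Mapping.lookup F m = Poly_Mapping.lookup
     (\<Sum>m\<in>Poly_Mapping.keys F. Poly_Mapping.single m (Poly_Mapping.lookup F m)) m"
    by (cases "m \<in> Poly_Mapping.keys F")
       (auto simp: lookup_sum lookup_single when_def sum.delta' in_keys_iff)
qed

lemma eval_mpoly_mult: "eval_mpoly vs (F * G) = eval_mpoly vs F * eval_mpoly vs G"
proof -
  let ?lF = "Poly_Mapping.lookup F" and ?lG = "Poly_Mapping.lookup G"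
  have "F * G = (\<Sum>m\<in>Poly_Mapping.keys F. Poly_Mapping.single m (?lF m)) *
                (\<Sum>m'\<in>Poly_Mapping.keys G. Poly_Mapping.single m' (?lG m'))"
    using mpoly_eq_sum_single[of F] mpoly_eq_sum_single[of G] by simp
  also have "\<dots> = (\<Sum>m\<in>Poly_Mapping.keys F. \<Sum>m'\<in>Poly_Mapping.keys G.
                    Poly_Mapping.single (m + m') (?lF m * ?lG m'))"
    by (simp add: sum_product mult_single)
  also have "eval_mpoly vs \<dots> = (\<Sum>m\<in>Poly_Mapping.keys F. \<Sum>m'\<in>Poly_Mapping.keys G.
                    (?lF m * eval_monomial vs m) * (?lG m' * eval_monomial vs m'))"
    by (simp add: eval_mpoly_sum eval_mpoly_single eval_monomial_add ac_simps)
  also have "\<dots> = eval_mpoly vs F * eval_mpoly vs G"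
    by (simp add: sum_product eval_mpoly_def eval_monomial_def)
  finally show ?thesis .
qed

section \<open>Multihomogeneous functions\<close>

text \<open>The functions on tuples of coordinate vectors that are given by a multihomogeneous polynomial.
  Working with the functions, closed under the ring operations with a degree count, avoids ever
  writing down a polynomial with its monomials.\<close>

definition hom_fun :: "nat list \<Rightarrow> (nat \<Rightarrow> nat) \<Rightarrow> ('k::field vec list \<Rightarrow> 'k) \<Rightarrow> bool" where
  "hom_fun ds d \<phi> \<longleftrightarrow> (\<exists>F. multihomogeneous ds d F \<and> (\<forall>vs. eval_mpoly vs F = \<phi> vs))"

lemma hom_fun_const: "hom_fun ds (\<lambda>_. 0) (\<lambda>_. c)"
  unfolding hom_fun_def
  by (rule exI[of _ "Poly_Mapping.single 0 c"])
     (auto simp: multihomogeneous_def eval_mpoly_single eval_monomial_def split: if_splits)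

lemma hom_fun_coord:
  assumes "i < length ds" "j \<le> ds ! i"
  shows "hom_fun ds (\<lambda>i'. if i' = i then 1 else 0) (\<lambda>vs. vs ! i $ j)"
proof -
  have "(\<Sum>j'\<le>ds ! i'. Poly_Mapping.lookup (Poly_Mapping.single (i, j) (Suc 0)) (i', j')) =
        (if i' = i then 1 else 0)" for i'
    using assms by (auto simp: lookup_single when_def)
  then show ?thesis
    unfolding hom_fun_def using assms
    by (intro exI[of _ "Poly_Mapping.single (Poly_Mapping.single (i, j) 1) 1"])
       (auto simp: multihomogeneous_def eval_mpoly_single eval_monomial_def)
qed

lemma hom_fun_add:
  assumes "hom_fun ds d \<phi>" "hom_fun ds d \<psi>"
  shows "hom_fun ds d (\<lambda>vs. \<phi> vs + \<psi> vs)"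
proof -
  obtain F G where FG: "multihomogeneous ds d F" "multihomogeneous ds d G"
    "\<And>vs. eval_mpoly vs F = \<phi> vs" "\<And>vs. eval_mpoly vs G = \<psi> vs"
    using assms unfolding hom_fun_def by blast
  have "multihomogeneous ds d (F + G)"
    using FG(1,2) Poly_Mapping.keys_add[of F G] unfolding multihomogeneous_def by blast
  with FG show ?thesis unfolding hom_fun_def by (intro exI[of _ "F + G"]) (simp add: eval_mpoly_add)
qed

lemma hom_fun_mult:
  assumes "hom_fun ds d \<phi>" "hom_fun ds e \<psi>" "\<And>i. i < length ds \<Longrightarrow> s i = d i + e i"
  shows "hom_fun ds s (\<lambda>vs. \<phi> vs * \<psi> vs)"
proof -
  obtain F G where FG: "multihomogeneous ds d F" "multihomogeneous ds e G"
    "\<And>vs. eval_mpoly vs F = \<phi> vs" "\<And>vs. eval_mpoly vs G = \<psi> vs"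
    using assms unfolding hom_fun_def by blast
  have "multihomogeneous ds s (F * G)"
    unfolding multihomogeneous_def
  proof (rule ballI)
    fix m assume "m \<in> Poly_Mapping.keys (F * G)"
    then obtain a b where m: "m = a + b" "a \<in> Poly_Mapping.keys F" "b \<in> Poly_Mapping.keys G"
      using Poly_Mapping.keys_mult[of F G] by blast
    show "(\<forall>x\<in>Poly_Mapping.keys m. fst x < length ds \<and> snd x \<le> ds ! fst x) \<and>
        (\<forall>i<length ds. (\<Sum>j\<le>ds ! i. Poly_Mapping.lookup m (i, j)) = s i)"
      using FG(1,2) m Poly_Mapping.keys_add[of a b] assms(3)
      by (fastforce simp: multihomogeneous_def lookup_add sum.distrib)
  qed
  with FG show ?thesis unfolding hom_fun_def by (intro exI[of _ "F * G"]) (simp add: eval_mpoly_mult)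
qed

lemma hom_fun_diff:
  assumes "hom_fun ds d \<phi>" "hom_fun ds d \<psi>"
  shows "hom_fun ds d (\<lambda>vs. \<phi> vs - \<psi> vs)"
proof -
  have "hom_fun ds d (\<lambda>vs. (- 1) * \<psi> vs)"
    by (rule hom_fun_mult[OF hom_fun_const assms(2)]) simp
  from hom_fun_add[OF assms(1) this] show ?thesis by simp
qed

lemma hom_fun_power:
  assumes "hom_fun ds d \<phi>" "\<And>i. i < length ds \<Longrightarrow> s i = n * d i"
  shows "hom_fun ds s (\<lambda>vs. \<phi> vs ^ n)"
  using assms(2)
proof (induction n arbitrary: s)
  case 0
  from hom_fun_mult[OF hom_fun_const[of ds 1] hom_fun_const[of ds 1], of s] 0 show ?case by simp
next
  case (Suc n)
  show ?case unfolding power_Suc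
    by (rule hom_fun_mult[OF assms(1) Suc.IH[of "\<lambda>i. n * d i"]]) (auto simp: Suc.prems)
qed

definition scale :: "(nat \<Rightarrow> 'k::field) \<Rightarrow> 'k vec list \<Rightarrow> 'k vec list" where
  "scale c vs = map (\<lambda>i. c i \<cdot>\<^sub>v vs ! i) [0..<length vs]"

lemma hom_fun_scale:
  assumes "hom_fun ds d \<phi>" "length vs = length ds"
    "\<And>i. i < length ds \<Longrightarrow> dim_vec (vs ! i) = Suc (ds ! i)"
  shows "\<phi> (scale c vs) = (\<Prod>i<length ds. c i ^ d i) * \<phi> vs"
proof -
  obtain F where F: "multihomogeneous ds d F" "\<And>vs. eval_mpoly vs F = \<phi> vs"
    using assms unfolding hom_fun_def by blast
  have "eval_monomial (scale c vs) m = (\<Prod>i<length ds. c i ^ d i) * eval_monomial vs m"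
    if m: "m \<in> Poly_Mapping.keys F" for m
  proof -
    let ?l = "Poly_Mapping.lookup m"
    define S where "S = (SIGMA i:{..<length ds}. {..ds ! i})"
    have S: "finite S" "Poly_Mapping.keys m \<subseteq> S"
      using F(1) m by (fastforce simp: S_def multihomogeneous_def)+
    have "eval_monomial (scale c vs) m = (\<Prod>x\<in>S. (c (fst x) * ((vs ! fst x) $ snd x)) ^ ?l x)"
      unfolding eval_monomial_superset[OF S] using assms(2,3)
      by (intro prod.cong) (auto simp: scale_def S_def le_imp_less_Suc)
    also have "\<dots> = (\<Prod>x\<in>S. c (fst x) ^ ?l x) * eval_monomial vs m"
      by (simp add: power_mult_distrib prod.distrib eval_monomial_superset[OF S])
    also have "(\<Prod>x\<in>S. c (fst x) ^ ?l x) = (\<Prod>i<length ds. \<Prod>j\<le>ds ! i. c i ^ ?l (i, j))"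
      unfolding S_def by (simp add: prod.Sigma split_def)
    also have "\<dots> = (\<Prod>i<length ds. c i ^ d i)"
      using F(1) m by (intro prod.cong) (auto simp: multihomogeneous_def simp flip: power_sum)
    finally show ?thesis .
  qed
  then have "eval_mpoly (scale c vs) F = (\<Prod>i<length ds. c i ^ d i) * eval_mpoly vs F"
    unfolding eval_mpoly_def eval_monomial_def[symmetric] sum_distrib_left
    by (intro sum.cong) auto
  with F show ?thesis by simp
qed

section \<open>Homogeneous coordinates\<close>

text \<open>Coordinate tuples without a zero vector, i.e. those that represent a point of the product of
  projective spaces of dimensions \<open>ds\<close>.\<close>

definition valid :: "nat list \<Rightarrow> 'k::field vec list \<Rightarrow> bool" where
  "valid ds vs \<longleftrightarrow> length vs = length ds \<and>
     (\<forall>i<length ds. vs ! i \<in> carrier_vec (Suc (ds ! i)) \<and> vs ! i \<noteq> 0\<^sub>v (Suc (ds ! i)))"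

abbreviation pt :: "'k::field vec list \<Rightarrow> 'k vec set list" where
  "pt vs \<equiv> map proj_pt vs"

lemma mem_listset: "xs \<in> listset As \<longleftrightarrow> list_all2 (\<in>) xs As"
  by (induction As arbitrary: xs) (auto simp: set_Cons_def list_all2_Cons2)

lemma mem_mproj: "p \<in> mproj ds \<longleftrightarrow> (\<exists>vs. valid ds vs \<and> p = pt vs)"
proof
  assume "p \<in> mproj ds"
  then have p: "length p = length ds" "\<And>i. i < length ds \<Longrightarrow> p ! i \<in> proj_space (ds ! i)"
    by (auto simp: mproj_def mem_listset list_all2_conv_all_nth)
  then have "\<forall>i<length ds. \<exists>v. v \<in> carrier_vec (Suc (ds ! i)) - {0\<^sub>v (Suc (ds ! i))} \<and> p ! i = proj_pt v"
    unfolding proj_space_def by blast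
  then obtain v where v: "\<And>i. i < length ds \<Longrightarrow>
      v i \<in> carrier_vec (Suc (ds ! i)) - {0\<^sub>v (Suc (ds ! i))} \<and> p ! i = proj_pt (v i)"
    by metis
  have "valid ds (map v [0..<length ds])" "p = pt (map v [0..<length ds])"
    using v p(1) by (auto simp: valid_def intro!: nth_equalityI)
  then show "\<exists>vs. valid ds vs \<and> p = pt vs" by blast
next
  assume "\<exists>vs. valid ds vs \<and> p = pt vs"
  then show "p \<in> mproj ds"
    by (auto simp: mproj_def mem_listset list_all2_conv_all_nth valid_def proj_space_def)
qed

lemma mem_listset_pt: "ws \<in> listset (pt vs) \<longleftrightarrow> (\<exists>c. (\<forall>i. c i \<noteq> 0) \<and> ws = scale c vs)"
proof
  assume "ws \<in> listset (pt vs)"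
  then have ws: "length ws = length vs" "\<And>i. i < length vs \<Longrightarrow> \<exists>c. ws ! i = c \<cdot>\<^sub>v vs ! i \<and> c \<noteq> 0"
    by (auto simp: mem_listset list_all2_conv_all_nth proj_pt_def)
  then obtain c where c: "\<And>i. i < length vs \<Longrightarrow> c i \<noteq> 0 \<and> ws ! i = c i \<cdot>\<^sub>v vs ! i"
    by metis
  have "ws = scale (\<lambda>i. if i < length vs then c i else 1) vs"
    using c ws(1) by (auto simp: scale_def intro!: nth_equalityI)
  with c show "\<exists>c. (\<forall>i. c i \<noteq> 0) \<and> ws = scale c vs"
    by (intro exI[of _ "\<lambda>i. if i < length vs then c i else 1"]) auto
next
  assume "\<exists>c. (\<forall>i. c i \<noteq> 0) \<and> ws = scale c vs"
  then show "ws \<in> listset (pt vs)"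
    by (fastforce simp: mem_listset list_all2_conv_all_nth proj_pt_def scale_def)
qed

lemma proj_pt_smult: "c \<noteq> 0 \<Longrightarrow> proj_pt (c \<cdot>\<^sub>v v) = proj_pt v"
  unfolding proj_pt_def
proof (safe, goal_cases)
  case (1 x a)
  then show ?case by (intro exI[of _ "a * c"]) (simp add: smult_smult_assoc)
next
  case (2 x a)
  then show ?case by (intro exI[of _ "a / c"]) (simp add: smult_smult_assoc)
qed

lemma pt_scale: "(\<And>i. i < length vs \<Longrightarrow> c i \<noteq> 0) \<Longrightarrow> pt (scale c vs) = pt vs"
  by (auto simp: scale_def proj_pt_smult intro!: nth_equalityI)

lemma smult_eq_zero_vec_iff:
  "(c::'k::field) \<noteq> 0 \<Longrightarrow> v \<in> carrier_vec n \<Longrightarrow> c \<cdot>\<^sub>v v = 0\<^sub>v n \<longleftrightarrow> v = 0\<^sub>v n"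
  by (auto simp: vec_eq_iff)

lemma valid_scale: "valid ds vs \<Longrightarrow> (\<And>i. c i \<noteq> 0) \<Longrightarrow> valid ds (scale c vs)"
  by (auto simp: valid_def scale_def smult_eq_zero_vec_iff)

lemma self_mem_listset: "vs \<in> listset (pt vs)"
  by (auto simp: mem_listset list_all2_conv_all_nth proj_pt_def intro!: exI[of _ 1])

lemma pt_eqD: "pt ws = pt vs \<Longrightarrow> \<exists>c. (\<forall>i. c i \<noteq> 0) \<and> ws = scale c vs"
  using self_mem_listset[of ws] by (simp add: mem_listset_pt)

lemma hom_fun_pt_cong:
  assumes "hom_fun ds d \<phi>" "valid ds vs" "pt ws = pt vs"
  shows "\<phi> ws = 0 \<longleftrightarrow> \<phi> vs = 0"
proof -
  obtain c where c: "\<And>i. c i \<noteq> 0" "ws = scale c vs"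
    using pt_eqD[OF assms(3)] by blast
  show ?thesis
    unfolding c(2) using hom_fun_scale[OF assms(1), of vs c] assms(2) c(1)
    by (auto simp: valid_def)
qed

definition nonvanish :: "nat list \<Rightarrow> ('k::field vec list \<Rightarrow> 'k) \<Rightarrow> 'k vec set list set" where
  "nonvanish ds \<phi> = {pt vs | vs. valid ds vs \<and> \<phi> vs \<noteq> 0}"

lemma pt_mem_nonvanish:
  assumes "hom_fun ds d \<phi>" "valid ds vs"
  shows "pt vs \<in> nonvanish ds \<phi> \<longleftrightarrow> \<phi> vs \<noteq> 0"
proof
  assume "pt vs \<in> nonvanish ds \<phi>"
  then obtain ws where ws: "pt ws = pt vs" "\<phi> ws \<noteq> 0"
    unfolding nonvanish_def by force
  then show "\<phi> vs \<noteq> 0" using hom_fun_pt_cong[OF assms ws(1)] by simp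
next
  assume "\<phi> vs \<noteq> 0"
  with assms(2) show "pt vs \<in> nonvanish ds \<phi>" unfolding nonvanish_def by blast
qed

text \<open>By homogeneity the value at one choice of coordinates decides whether a point lies in a basic
  open set; everything below is computed with one chosen tuple of coordinates.\<close>

lemma basic_open_eq_nonvanish:
  assumes "multihomogeneous ds d F"
  shows "basic_open ds F = nonvanish ds (\<lambda>vs. eval_mpoly vs F)"
proof -
  have h: "hom_fun ds d (\<lambda>vs. eval_mpoly vs F)" using assms unfolding hom_fun_def by blast
  show ?thesis
  proof (safe, goal_cases)
    case (1 p)
    then obtain vs where "valid ds vs" "p = pt vs" by (auto simp: basic_open_def mem_mproj)
    with 1 self_mem_listset[of vs] show ?case by (auto simp: basic_open_def nonvanish_def)
  next
    case (2 p)
    then obtain vs where vs: "valid ds vs" "p = pt vs" "eval_mpoly vs F \<noteq> 0"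
      by (auto simp: nonvanish_def)
    have "eval_mpoly ws F \<noteq> 0" if "ws \<in> listset p" for ws
    proof -
      have "pt ws = pt vs"
        using that unfolding vs mem_listset_pt by (auto simp: pt_scale)
      then show ?thesis using hom_fun_pt_cong[OF h vs(1)] vs(3) by blast
    qed
    with vs show ?case by (auto simp: basic_open_def mem_mproj)
  qed
qed

lemma openin_nonvanish:
  assumes "hom_fun ds d \<phi>"
  shows "openin (zariski ds) (nonvanish ds \<phi>)"
proof -
  obtain F where F: "multihomogeneous ds d F" "(\<lambda>vs. eval_mpoly vs F) = \<phi>"
    using assms unfolding hom_fun_def by blast
  then show ?thesis
    using basic_open_eq_nonvanish[OF F(1)] unfolding zariski_def
    by (intro topology_generated_by_Basis) blast
qed

lemma topspace_zariski: "topspace (zariski ds) = mproj ds"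
proof
  show "topspace (zariski ds) \<subseteq> mproj ds"
    by (auto simp: zariski_def basic_open_def)
  have "mproj ds = nonvanish ds (\<lambda>_. 1 :: 'a)"
    by (auto simp: nonvanish_def mem_mproj)
  then show "mproj ds \<subseteq> topspace (zariski ds :: 'a vec set list topology)"
    using openin_subset[OF openin_nonvanish[OF hom_fun_const]] by metis
qed

section \<open>Maps given by multihomogeneous functions\<close>

definition hom_map :: "nat list \<Rightarrow> nat list \<Rightarrow> ('k::field vec list \<Rightarrow> 'k vec list) \<Rightarrow> bool" where
  "hom_map ds es F \<longleftrightarrow>
     (\<forall>vs. length (F vs) = length es \<and> (\<forall>i<length es. F vs ! i \<in> carrier_vec (Suc (es ! i)))) \<and>
     (\<forall>i<length es. \<exists>d. \<forall>j\<le>es ! i. hom_fun ds d (\<lambda>vs. F vs ! i $ j))"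

text \<open>The choice of coordinates is arbitrary: for a homogeneous \<open>F\<close> the resulting point does not depend
  on it (lemma \<open>proj_map_pt\<close>).\<close>

definition proj_map :: "('k::field vec list \<Rightarrow> 'k vec list) \<Rightarrow> 'k vec set list \<Rightarrow> 'k vec set list" where
  "proj_map F p = pt (F (SOME vs. vs \<in> listset p))"

lemma hom_map_pt_cong:
  assumes "hom_map ds es F" "valid ds vs" "pt ws = pt vs"
  shows "pt (F ws) = pt (F vs)"
proof -
  obtain c where c: "\<And>i. c i \<noteq> 0" "ws = scale c vs"
    using pt_eqD[OF assms(3)] by blast
  have len: "length (F us) = length es" "\<And>i. i < length es \<Longrightarrow> dim_vec (F us ! i) = Suc (es ! i)" for us
    using assms(1) by (auto simp: hom_map_def)
  have "proj_pt (F ws ! i) = proj_pt (F vs ! i)" if i: "i < length es" for i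
  proof -
    obtain d where d: "\<And>j. j \<le> es ! i \<Longrightarrow> hom_fun ds d (\<lambda>vs. F vs ! i $ j)"
      using assms(1) i unfolding hom_map_def by blast
    let ?a = "\<Prod>i<length ds. c i ^ d i"
    have "F ws ! i $ j = ?a * F vs ! i $ j" if "j \<le> es ! i" for j
      using hom_fun_scale[OF d[OF that], of vs c] assms(2) c(2) by (simp add: valid_def)
    then have "F ws ! i = ?a \<cdot>\<^sub>v F vs ! i"
      using i by (intro eq_vecI) (auto simp: len less_Suc_eq_le)
    moreover have "?a \<noteq> 0" using c(1) by simp
    ultimately show ?thesis using proj_pt_smult by metis
  qed
  then show ?thesis by (intro nth_equalityI) (auto simp: len)
qed

lemma proj_map_pt:
  assumes "hom_map ds es F" "valid ds vs"
  shows "proj_map F (pt vs) = pt (F vs)"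
proof -
  have "(SOME ws. ws \<in> listset (pt vs)) \<in> listset (pt vs)"
    using self_mem_listset by (rule someI)
  then have "pt (SOME ws. ws \<in> listset (pt vs)) = pt vs"
    unfolding mem_listset_pt by (metis pt_scale)
  then show ?thesis
    unfolding proj_map_def by (rule hom_map_pt_cong[OF assms])
qed

lemma regular_map_proj_map:
  assumes F: "hom_map ds es F" and U: "U \<subseteq> mproj ds"
    and val: "\<And>vs. valid ds vs \<Longrightarrow> pt vs \<in> U \<Longrightarrow> valid es (F vs)"
  shows "regular_map ds es U (proj_map F)"
proof -
  have "\<forall>i\<in>{..<length es}. \<exists>\<Phi>. (\<exists>d. \<forall>j\<le>es ! i. multihomogeneous ds d (\<Phi> j)) \<and>
          (\<forall>j\<le>es ! i. \<forall>vs. eval_mpoly vs (\<Phi> j) = F vs ! i $ j)"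
  proof
    fix i assume "i \<in> {..<length es}"
    then obtain d where "\<forall>j\<le>es ! i. hom_fun ds d (\<lambda>vs. F vs ! i $ j)"
      using F unfolding hom_map_def by blast
    then have "\<forall>j. \<exists>f. j \<le> es ! i \<longrightarrow> multihomogeneous ds d f \<and> (\<forall>vs. eval_mpoly vs f = F vs ! i $ j)"
      unfolding hom_fun_def by blast
    then obtain \<Phi> where "\<forall>j. j \<le> es ! i \<longrightarrow>
        multihomogeneous ds d (\<Phi> j) \<and> (\<forall>vs. eval_mpoly vs (\<Phi> j) = F vs ! i $ j)"
      using choice[of "\<lambda>j f. j \<le> es ! i \<longrightarrow> multihomogeneous ds d f \<and> (\<forall>vs. eval_mpoly vs f = F vs ! i $ j)"]
      by blast
    then show "\<exists>\<Phi>. (\<exists>d. \<forall>j\<le>es ! i. multihomogeneous ds d (\<Phi> j)) \<and>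
          (\<forall>j\<le>es ! i. \<forall>vs. eval_mpoly vs (\<Phi> j) = F vs ! i $ j)" by blast
  qed
  from bchoice[OF this] obtain \<Phi> where "\<forall>i\<in>{..<length es}. (\<exists>d. \<forall>j\<le>es ! i. multihomogeneous ds d (\<Phi> i j)) \<and>
          (\<forall>j\<le>es ! i. \<forall>vs. eval_mpoly vs (\<Phi> i j) = F vs ! i $ j)" by blast
  then have \<Phi>:
    "\<And>i. i < length es \<Longrightarrow> \<exists>d. \<forall>j\<le>es ! i. multihomogeneous ds d (\<Phi> i j)"
    "\<And>i j vs. i < length es \<Longrightarrow> j \<le> es ! i \<Longrightarrow> eval_mpoly vs (\<Phi> i j) = F vs ! i $ j"
    by auto
  have dims: "length (F vs) = length es" "i < length es \<Longrightarrow> F vs ! i \<in> carrier_vec (Suc (es ! i))" for vs i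
    using F by (auto simp: hom_map_def)
  have w: "Matrix.vec (Suc (es ! i)) (\<lambda>j. eval_mpoly vs (\<Phi> i j)) = F vs ! i" if "i < length es" for i vs
    using dims(2)[OF that, of vs] by (intro eq_vecI) (auto simp: \<Phi>(2)[OF that])
  have "given_by ds es \<Phi> U (proj_map F)"
    unfolding given_by_def
  proof (intro conjI ballI allI impI, goal_cases)
    case (1 i)
    then show ?case by (rule \<Phi>(1))
  next
    case (2 p vs i)
    obtain us where us: "valid ds us" "p = pt us" using 2(1) U mem_mproj by blast
    then obtain c where c: "\<And>i. c i \<noteq> 0" "vs = scale c us" using 2(2) by (auto simp: mem_listset_pt)
    have vs: "valid ds vs" "p = pt vs" using us c by (auto simp: valid_scale pt_scale)
    then have "valid es (F vs)" using val 2(1) by blast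
    then show ?case
      using 2(3) dims(1) by (auto simp: w valid_def vs(2) proj_map_pt[OF F vs(1)])
  qed
  moreover have "openin (subtopology (zariski ds) U) U"
    using U by (auto simp: openin_subtopology_refl topspace_zariski)
  moreover have "proj_map F ` U \<subseteq> mproj es"
  proof safe
    fix p assume p: "p \<in> U"
    then obtain vs where "valid ds vs" "p = pt vs" using U mem_mproj by blast
    with p val show "proj_map F p \<in> mproj es" by (auto simp: proj_map_pt[OF F] mem_mproj)
  qed
  ultimately show ?thesis unfolding regular_map_def by blast
qed

text \<open>This reduces the birational equivalence to identities between coordinate vectors: two homogeneous
  maps that are mutually inverse up to scalars where two forms \<open>P\<close> and \<open>Q\<close> do not vanish, each of
  the two nonvanishing loci being mapped into the other.\<close>

lemma equivariantly_birationalI: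
  assumes X: "X \<subseteq> mproj ds" and Y: "Y \<subseteq> mproj es"
    and F: "hom_map ds es F" and G: "hom_map es ds G"
    and P: "hom_fun ds d P" and Q: "hom_fun es e Q"
    and dX: "dense_open ds X (X \<inter> nonvanish ds P)" and dY: "dense_open es Y (Y \<inter> nonvanish es Q)"
    and FX: "\<And>vs. valid ds vs \<Longrightarrow> pt vs \<in> X \<Longrightarrow> P vs \<noteq> 0 \<Longrightarrow>
          valid es (F vs) \<and> pt (F vs) \<in> Y \<and> Q (F vs) \<noteq> 0 \<and> pt (G (F vs)) = pt vs"
    and GY: "\<And>ws. valid es ws \<Longrightarrow> pt ws \<in> Y \<Longrightarrow> Q ws \<noteq> 0 \<Longrightarrow>
          valid ds (G ws) \<and> pt (G ws) \<in> X \<and> P (G ws) \<noteq> 0 \<and> pt (F (G ws)) = pt ws"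
    and eq: "\<And>\<gamma> vs. \<gamma> \<in> carrier \<Gamma> \<Longrightarrow> valid ds vs \<Longrightarrow> pt vs \<in> X \<Longrightarrow> P vs \<noteq> 0 \<Longrightarrow>
          \<exists>vs'. valid ds vs' \<and> a \<gamma> (pt vs) = pt vs' \<and> pt (F vs') = b \<gamma> (pt (F vs))"
  shows "equivariantly_birational \<Gamma> ds X a es Y b"
proof -
  let ?U = "X \<inter> nonvanish ds P" and ?W = "Y \<inter> nonvanish es Q"
  have memU: "\<exists>vs. valid ds vs \<and> pt vs \<in> X \<and> P vs \<noteq> 0 \<and> p = pt vs" if "p \<in> ?U" for p
    using that unfolding nonvanish_def by blast
  have memW: "\<exists>vs. valid es vs \<and> pt vs \<in> Y \<and> Q vs \<noteq> 0 \<and> p = pt vs" if "p \<in> ?W" for p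
    using that unfolding nonvanish_def by blast
  have f: "proj_map F p \<in> ?W \<and> proj_map G (proj_map F p) = p" if p: "p \<in> ?U" for p
  proof -
    obtain vs where vs: "valid ds vs" "pt vs \<in> X" "P vs \<noteq> 0" "p = pt vs" using memU[OF p] by blast
    note * = FX[OF vs(1-3)]
    then show ?thesis
      unfolding vs(4) proj_map_pt[OF F vs(1)] using proj_map_pt[OF G, of "F vs"] * pt_mem_nonvanish[OF Q]
      by simp
  qed
  have g: "proj_map G q \<in> ?U \<and> proj_map F (proj_map G q) = q" if q: "q \<in> ?W" for q
  proof -
    obtain vs where vs: "valid es vs" "pt vs \<in> Y" "Q vs \<noteq> 0" "q = pt vs" using memW[OF q] by blast
    note * = GY[OF vs(1-3)]
    then show ?thesis
      unfolding vs(4) proj_map_pt[OF G vs(1)] using proj_map_pt[OF F, of "G vs"] * pt_mem_nonvanish[OF P]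
      by simp
  qed
  have "regular_map ds es ?U (proj_map F)"
    using X FX by (intro regular_map_proj_map F) (auto simp: pt_mem_nonvanish[OF P])
  moreover have "regular_map es ds ?W (proj_map G)"
    using Y GY by (intro regular_map_proj_map G) (auto simp: pt_mem_nonvanish[OF Q])
  moreover have "proj_map F (a \<gamma> p) = b \<gamma> (proj_map F p)" if \<gamma>: "\<gamma> \<in> carrier \<Gamma>" and p: "p \<in> ?U" for \<gamma> p
  proof -
    obtain vs where vs: "valid ds vs" "pt vs \<in> X" "P vs \<noteq> 0" "p = pt vs" using memU[OF p] by blast
    obtain vs' where "valid ds vs'" "a \<gamma> (pt vs) = pt vs'" "pt (F vs') = b \<gamma> (pt (F vs))"
      using eq[OF \<gamma> vs(1-3)] by blast
    then show ?thesis by (simp add: vs(4) proj_map_pt[OF F] vs(1))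
  qed
  ultimately show ?thesis
    unfolding equivariantly_birational_def using dX dY f g
    by (intro exI[of _ ?U] exI[of _ ?W] exI[of _ "proj_map F"] exI[of _ "proj_map G"])
       (simp add: image_subset_iff)
qed

section \<open>Density of open sets via polynomial curves\<close>

definition is_poly :: "('k::field \<Rightarrow> 'k) \<Rightarrow> bool" where
  "is_poly f \<longleftrightarrow> (\<exists>P. \<forall>t. f t = poly P t)"

lemma is_poly_const: "is_poly (\<lambda>_. c)"
  unfolding is_poly_def by (intro exI[of _ "[:c:]"]) simp

lemma is_poly_id: "is_poly (\<lambda>t. t)"
  unfolding is_poly_def by (intro exI[of _ "[:0, 1:]"]) simp

lemma is_poly_add: "is_poly f \<Longrightarrow> is_poly g \<Longrightarrow> is_poly (\<lambda>t. f t + g t)"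
  unfolding is_poly_def by (metis poly_add)

lemma is_poly_diff: "is_poly f \<Longrightarrow> is_poly g \<Longrightarrow> is_poly (\<lambda>t. f t - g t)"
  unfolding is_poly_def by (metis poly_diff)

lemma is_poly_mult: "is_poly f \<Longrightarrow> is_poly g \<Longrightarrow> is_poly (\<lambda>t. f t * g t)"
  unfolding is_poly_def by (metis poly_mult)

lemma is_poly_power: "is_poly f \<Longrightarrow> is_poly (\<lambda>t. f t ^ n)"
  unfolding is_poly_def by (metis poly_power)

lemma is_poly_sum: "(\<And>x. x \<in> A \<Longrightarrow> is_poly (f x)) \<Longrightarrow> is_poly (\<lambda>t. \<Sum>x\<in>A. f x t)"
  by (induction A rule: infinite_finite_induct) (auto intro: is_poly_const is_poly_add)

lemma is_poly_prod: "(\<And>x. x \<in> A \<Longrightarrow> is_poly (f x)) \<Longrightarrow> is_poly (\<lambda>t. \<Prod>x\<in>A. f x t)"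
  by (induction A rule: infinite_finite_induct) (auto intro: is_poly_const is_poly_mult)

lemmas is_poly_intros = is_poly_const is_poly_id is_poly_add is_poly_diff is_poly_mult is_poly_power

lemma is_poly_finite_zeros:
  assumes "is_poly f" "f t0 \<noteq> 0"
  shows "finite {t. f t = 0}"
proof -
  obtain P where P: "\<And>t. f t = poly P t" using assms(1) unfolding is_poly_def by blast
  with assms(2) have "P \<noteq> 0" by auto
  then show ?thesis unfolding P by (rule poly_roots_finite)
qed

definition curve :: "nat list \<Rightarrow> ('k::field \<Rightarrow> 'k vec list) \<Rightarrow> bool" where
  "curve ds c \<longleftrightarrow>
     (\<forall>t. length (c t) = length ds \<and> (\<forall>i<length ds. c t ! i \<in> carrier_vec (Suc (ds ! i)))) \<and>
     (\<forall>i<length ds. \<forall>j\<le>ds ! i. is_poly (\<lambda>t. c t ! i $ j))"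

lemma is_poly_hom_fun_curve:
  assumes "hom_fun ds d \<phi>" "curve ds c"
  shows "is_poly (\<lambda>t. \<phi> (c t))"
proof -
  obtain F where F: "multihomogeneous ds d F" "(\<lambda>t. \<phi> (c t)) = (\<lambda>t. eval_mpoly (c t) F)"
    using assms(1) unfolding hom_fun_def by metis
  show ?thesis
    unfolding F(2) eval_mpoly_def using F(1) assms(2)
    by (intro is_poly_sum is_poly_mult is_poly_const is_poly_prod is_poly_power)
       (auto simp: multihomogeneous_def curve_def)
qed

lemma finite_invalid:
  assumes "curve ds c" "valid ds (c t0)"
  shows "finite {t. \<not> valid ds (c t)}"
proof -
  have "finite {t. c t ! i = 0\<^sub>v (Suc (ds ! i))}" if i: "i < length ds" for i
  proof -
    have "c t0 ! i \<in> carrier_vec (Suc (ds ! i))" "c t0 ! i \<noteq> 0\<^sub>v (Suc (ds ! i))"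
      using assms(2) i by (auto simp: valid_def)
    then obtain j where j: "j \<le> ds ! i" "c t0 ! i $ j \<noteq> 0"
      by (auto simp: vec_eq_iff less_Suc_eq_le)
    have "finite {t. c t ! i $ j = 0}"
      using assms(1) i j by (intro is_poly_finite_zeros[where ?t0.0 = t0]) (auto simp: curve_def)
    then show ?thesis
      by (rule finite_subset[rotated]) (use j in auto)
  qed
  then have "finite (\<Union>i<length ds. {t. c t ! i = 0\<^sub>v (Suc (ds ! i))})" by blast
  then show ?thesis
    by (rule finite_subset[rotated]) (use assms(1) in \<open>auto simp: valid_def curve_def\<close>)
qed

lemma valid_pt_cong: "valid ds vs \<Longrightarrow> pt ws = pt vs \<Longrightarrow> valid ds ws"
  using pt_eqD valid_scale by metis

lemma curve_in_nonvanish: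
  assumes "hom_fun ds d \<phi>" "curve ds c" "pt (c t0) \<in> nonvanish ds \<phi>"
  shows "finite {t. pt (c t) \<notin> nonvanish ds \<phi>}"
proof -
  have v: "valid ds (c t0)" using assms(3) valid_pt_cong unfolding nonvanish_def by blast
  have nz: "\<phi> (c t0) \<noteq> 0" using assms(3) pt_mem_nonvanish[OF assms(1) v] by blast
  have "finite ({t. \<not> valid ds (c t)} \<union> {t. \<phi> (c t) = 0})"
    using finite_invalid[OF assms(2) v] is_poly_finite_zeros[OF is_poly_hom_fun_curve[OF assms(1,2)], of t0] nz
    by blast
  then show ?thesis
    by (rule finite_subset[rotated]) (auto simp: nonvanish_def)
qed

text \<open>Irreducibility in the form in which it is used: a polynomial curve that meets an open set stays in
  it for all but finitely many parameters. The property passes to finite intersections and to unions,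
  so it suffices to check it for basic open sets, where it says that a nonzero polynomial in one
  variable has finitely many roots.\<close>

lemma curve_in_open:
  assumes "openin (zariski ds) V" "curve ds c" "pt (c t0) \<in> V"
  shows "finite {t. pt (c t) \<notin> V}"
proof -
  have "generate_topology_on {basic_open ds F | F d. multihomogeneous ds d F} V"
    using assms(1) unfolding zariski_def by (rule openin_topology_generated_by)
  then have "\<forall>t0. pt (c t0) \<in> V \<longrightarrow> finite {t. pt (c t) \<notin> V}"
  proof induction
    case Empty
    then show ?case by simp
  next
    case (Int a b)
    show ?case
    proof (intro allI impI)
      fix t0 assume "pt (c t0) \<in> a \<inter> b"
      then have "finite ({t. pt (c t) \<notin> a} \<union> {t. pt (c t) \<notin> b})" using Int.IH by blast
      then show "finite {t. pt (c t) \<notin> a \<inter> b}"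
        by (rule rev_finite_subset) blast
    qed
  next
    case (UN K)
    show ?case
    proof (intro allI impI)
      fix t0 assume "pt (c t0) \<in> \<Union>K"
      then obtain k where k: "k \<in> K" "pt (c t0) \<in> k" by blast
      then have "finite {t. pt (c t) \<notin> k}" using UN.IH by blast
      then show "finite {t. pt (c t) \<notin> \<Union>K}"
        by (rule rev_finite_subset) (use k in blast)
    qed
  next
    case (Basis s)
    then obtain F d where F: "multihomogeneous ds d F" "s = nonvanish ds (\<lambda>vs. eval_mpoly vs F)"
      using basic_open_eq_nonvanish by blast
    have "hom_fun ds d (\<lambda>vs. eval_mpoly vs F)" using F(1) unfolding hom_fun_def by blast
    from curve_in_nonvanish[OF this assms(2)] show ?case unfolding F(2) by blast
  qed
  with assms(3) show ?thesis by blast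
qed

text \<open>If every point of \<open>X\<close> can be joined inside \<open>X\<close> by a polynomial curve to the locus where \<open>\<phi>\<close> is
  nonzero, then every neighbourhood of the point meets that locus, because both conditions fail only
  for finitely many parameters of the curve and the field is infinite.\<close>

lemma dense_open_nonvanish:
  fixes \<phi> :: "'k::field_char_0 vec list \<Rightarrow> 'k"
  assumes \<phi>: "hom_fun ds d \<phi>" and X: "X \<subseteq> mproj ds"
    and connect: "\<And>vs. valid ds vs \<Longrightarrow> pt vs \<in> X \<Longrightarrow>
      \<exists>c t0 t1. curve ds c \<and> pt (c t0) = pt vs \<and> pt (c t1) \<in> nonvanish ds \<phi> \<and>
        (\<forall>t. valid ds (c t) \<longrightarrow> pt (c t) \<in> X)"
  shows "dense_open ds X (X \<inter> nonvanish ds \<phi>)"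
  unfolding dense_open_def
proof (intro conjI)
  show "openin (subtopology (zariski ds) X) (X \<inter> nonvanish ds \<phi>)"
    using openin_nonvanish[OF \<phi>] by (auto simp: openin_subtopology)
  have top: "topspace (subtopology (zariski ds) X) = X"
    using X by (auto simp: topspace_zariski)
  show "subtopology (zariski ds) X closure_of (X \<inter> nonvanish ds \<phi>) = X"
  proof
    show "subtopology (zariski ds) X closure_of (X \<inter> nonvanish ds \<phi>) \<subseteq> X"
      using closure_of_subset_topspace[of "subtopology (zariski ds) X"] top by metis
    show "X \<subseteq> subtopology (zariski ds) X closure_of (X \<inter> nonvanish ds \<phi>)"
    proof
      fix p assume p: "p \<in> X"
      then obtain vs where vs: "valid ds vs" "p = pt vs" using X mem_mproj by blast
      obtain c t0 t1 where c: "curve ds c" "pt (c t0) = p" "pt (c t1) \<in> nonvanish ds \<phi>"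
        "\<And>t. valid ds (c t) \<Longrightarrow> pt (c t) \<in> X"
        using connect[OF vs(1)] p vs(2) by blast
      have "\<exists>q. q \<in> X \<inter> nonvanish ds \<phi> \<and> q \<in> V \<inter> X" if V: "openin (zariski ds) V" "p \<in> V" for V
      proof -
        have "finite ({t. pt (c t) \<notin> V} \<union> {t. pt (c t) \<notin> nonvanish ds \<phi>})"
          using curve_in_open[OF V(1) c(1), of t0] curve_in_nonvanish[OF \<phi> c(1,3)] V(2) c(2) by simp
        then obtain t where t: "pt (c t) \<in> V" "pt (c t) \<in> nonvanish ds \<phi>"
          using ex_new_if_finite[OF infinite_UNIV_char_0] by blast
        then have "valid ds (c t)" using valid_pt_cong unfolding nonvanish_def by blast
        with c(4) t show ?thesis by blast
      qed
      with p show "p \<in> subtopology (zariski ds) X closure_of (X \<inter> nonvanish ds \<phi>)"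
        unfolding in_closure_of top openin_subtopology by blast
    qed
  qed
qed

section \<open>Monomial representations of dihedral groups\<close>

definition monomial_mat :: "nat \<Rightarrow> (nat \<Rightarrow> nat) \<Rightarrow> (nat \<Rightarrow> 'k::field) \<Rightarrow> 'k mat" where
  "monomial_mat N \<pi> w = mat N N (\<lambda>(i, j). if j = \<pi> i then w i else 0)"

lemma monomial_mat_carrier [simp]: "monomial_mat N \<pi> w \<in> carrier_mat N N"
  by (simp add: monomial_mat_def)

lemma monomial_mat_cong:
  "(\<And>i. i < N \<Longrightarrow> \<pi> i = \<pi>' i) \<Longrightarrow> (\<And>i. i < N \<Longrightarrow> w i = w' i) \<Longrightarrow>
   monomial_mat N \<pi> w = monomial_mat N \<pi>' w'"
  by (auto simp: monomial_mat_def intro!: cong_mat)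

lemma monomial_mat_mult:
  assumes "\<And>i. i < N \<Longrightarrow> \<pi> i < N"
  shows "monomial_mat N \<pi> w * monomial_mat N \<pi>' w' = monomial_mat N (\<pi>' \<circ> \<pi>) (\<lambda>i. w i * w' (\<pi> i))"
proof (rule eq_matI)
  fix i j assume "i < dim_row (monomial_mat N (\<pi>' \<circ> \<pi>) (\<lambda>i. w i * w' (\<pi> i)))"
    "j < dim_col (monomial_mat N (\<pi>' \<circ> \<pi>) (\<lambda>i. w i * w' (\<pi> i)))"
  then have ij: "i < N" "j < N" by (auto simp: monomial_mat_def)
  then have "(monomial_mat N \<pi> w * monomial_mat N \<pi>' w') $$ (i, j) =
    (\<Sum>k\<in>{0..<N}. (if k = \<pi> i then w i else 0) * (if j = \<pi>' k then w' k else 0))"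
    by (auto simp: monomial_mat_def scalar_prod_def intro!: sum.cong)
  also have "\<dots> = (\<Sum>k\<in>{0..<N}. if k = \<pi> i then w i * (if j = \<pi>' k then w' k else 0) else 0)"
    by (intro sum.cong) auto
  also have "\<dots> = w i * (if j = \<pi>' (\<pi> i) then w' (\<pi> i) else 0)"
    using assms[OF ij(1)] by simp
  finally show "(monomial_mat N \<pi> w * monomial_mat N \<pi>' w') $$ (i, j) =
      monomial_mat N (\<pi>' \<circ> \<pi>) (\<lambda>i. w i * w' (\<pi> i)) $$ (i, j)"
    using ij by (simp add: monomial_mat_def)
qed (auto simp: monomial_mat_def)

lemma monomial_mat_mult_vec:
  assumes "v \<in> carrier_vec N" "i < N" "\<pi> i < N"
  shows "(monomial_mat N \<pi> w *\<^sub>v v) $ i = w i * v $ \<pi> i"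
proof -
  have "(monomial_mat N \<pi> w *\<^sub>v v) $ i = (\<Sum>k\<in>{0..<N}. (if k = \<pi> i then w i else 0) * v $ k)"
    using assms by (auto simp: monomial_mat_def scalar_prod_def intro!: sum.cong)
  also have "\<dots> = (\<Sum>k\<in>{0..<N}. if k = \<pi> i then w i * v $ k else 0)"
    by (intro sum.cong) auto
  finally show ?thesis using assms by simp
qed

text \<open>The reflection exchanges the coordinates \<open>2 i\<close> and \<open>2 i + 1\<close> among the first \<open>n\<close> ones
  (\<open>n\<close> even) and fixes the others.\<close>

definition pair_swap :: "nat \<Rightarrow> nat \<Rightarrow> nat" where
  "pair_swap n i = (if i < n then if even i then Suc i else i - 1 else i)"

lemma pair_swap_less: "even n \<Longrightarrow> n \<le> N \<Longrightarrow> i < N \<Longrightarrow> pair_swap n i < N"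
  unfolding pair_swap_def by (auto simp: less_Suc_eq) (metis Suc_lessI even_Suc order_less_le_trans)

lemma pair_swap_pair_swap: "even n \<Longrightarrow> pair_swap n (pair_swap n i) = i"
  unfolding pair_swap_def by (auto elim!: oddE) (metis Suc_lessI even_Suc)

text \<open>A direct sum of standard two-dimensional representations and of one-dimensional ones: the rotation acts
  diagonally with the eigenvalues \<open>w\<close>, which the reflection permutes.\<close>

definition dihedral_mat :: "nat \<Rightarrow> nat \<Rightarrow> (nat \<Rightarrow> 'k::field) \<Rightarrow> int \<times> bool \<Rightarrow> 'k mat" where
  "dihedral_mat N n w = (\<lambda>(a, s). monomial_mat N (if s then pair_swap n else id) (\<lambda>i. w i powi a))"

locale dihedral_weights =
  fixes N n m :: nat and w :: "nat \<Rightarrow> 'k::field"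
  assumes n: "even n" "n \<le> N" and m: "m > 0"
    and root: "\<And>i. i < N \<Longrightarrow> w i ^ m = 1"
    and swap: "\<And>i. i < N \<Longrightarrow> w (pair_swap n i) = inverse (w i)"
begin

lemma nonzero: "i < N \<Longrightarrow> w i \<noteq> 0"
  using root m by (metis power_0_left less_not_refl2 zero_neq_one)

lemma dihedral_mat_mult:
  "dihedral_mat N n w (a, s) * dihedral_mat N n w (b, t) =
   dihedral_mat N n w (if s then a - b else a + b, s \<noteq> t)"
  unfolding dihedral_mat_def prod.case
  by (subst monomial_mat_mult)
     (auto simp: pair_swap_less n pair_swap_pair_swap swap nonzero power_int_add power_int_diff
        power_int_inverse divide_inverse intro!: monomial_mat_cong)

lemma dihedral_mat_mod: "dihedral_mat N n w (a mod int m, s) = dihedral_mat N n w (a, s)"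
proof -
  have "w i powi (a mod int m) = w i powi a" if i: "i < N" for i
  proof -
    have "w i powi a = w i powi (int m * (a div int m) + a mod int m)" by simp
    also have "\<dots> = (w i powi int m) powi (a div int m) * w i powi (a mod int m)"
      by (simp only: power_int_add[OF disjI1[OF nonzero[OF i]]] power_int_mult)
    also have "w i powi int m = 1" using root[OF i] by simp
    finally show ?thesis by simp
  qed
  then show ?thesis by (auto simp: dihedral_mat_def intro!: monomial_mat_cong)
qed

lemma dihedral_mat_one: "dihedral_mat N n w (0, False) = 1\<^sub>m N"
  by (auto simp: dihedral_mat_def monomial_mat_def intro!: eq_matI)

lemma dihedral_mat_hom: "dihedral_mat N n w \<in> hom (dihedral m) (GL N)"
proof (rule homI)
  fix x assume "x \<in> carrier (dihedral m)"
  obtain a s where x: "x = (a, s)" by (cases x)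
  define y where "y = (if s then a else - a, s)"
  have "dihedral_mat N n w y * dihedral_mat N n w x = 1\<^sub>m N"
    "dihedral_mat N n w x * dihedral_mat N n w y = 1\<^sub>m N"
    by (simp_all add: x y_def dihedral_mat_mult flip: dihedral_mat_one)
  moreover have "dihedral_mat N n w x \<in> carrier_mat N N" "dihedral_mat N n w y \<in> carrier_mat N N"
    by (simp_all add: x y_def dihedral_mat_def)
  ultimately show "dihedral_mat N n w x \<in> carrier (GL N)"
    by (auto simp: units_of_def Units_def ring_mat_def intro!: bexI[of _ "dihedral_mat N n w y"])
next
  fix x y
  show "dihedral_mat N n w (x \<otimes>\<^bsub>dihedral m\<^esub> y) =
      dihedral_mat N n w x \<otimes>\<^bsub>GL N\<^esub> dihedral_mat N n w y"
    by (cases x; cases y)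
       (simp add: dihedral_def units_of_def ring_mat_def dihedral_mat_mult dihedral_mat_mod)
qed

end

text \<open>A rotation and a reflection generate the dihedral group. The base case of the induction,
  equality at the neutral element, comes from writing that element as the square of the reflection.\<close>

lemma dihedral_hom_eqI:
  assumes f: "f \<in> hom (dihedral m) H" and g: "g \<in> hom (dihedral m) H" and m: "m > 1"
    and rot: "f rotation = g rotation" and ref: "f reflection = g reflection"
    and x: "x \<in> carrier (dihedral m)"
  shows "f x = g x"
proof -
  have mult: "h (x \<otimes>\<^bsub>dihedral m\<^esub> y) = h x \<otimes>\<^bsub>H\<^esub> h y"
    if "h \<in> hom (dihedral m) H" "x \<in> carrier (dihedral m)" "y \<in> carrier (dihedral m)" for h x y
    using that by (simp add: hom_def)
  have gens: "rotation \<in> carrier (dihedral m)" "reflection \<in> carrier (dihedral m)"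
    using m by (auto simp: rotation_def reflection_def dihedral_def)
  have pow: "f (int a, False) = g (int a, False)" if "a < m" for a
    using that
  proof (induction a)
    case 0
    have "(int 0, False) = reflection \<otimes>\<^bsub>dihedral m\<^esub> reflection"
      by (simp add: reflection_def dihedral_def)
    then show ?case using mult[OF f gens(2,2)] mult[OF g gens(2,2)] ref by simp
  next
    case (Suc a)
    have a: "(int a, False) \<in> carrier (dihedral m)" using Suc.prems by (simp add: dihedral_def)
    have "(int (Suc a), False) = rotation \<otimes>\<^bsub>dihedral m\<^esub> (int a, False)"
      using Suc.prems by (simp add: rotation_def dihedral_def)
    then show ?case using mult[OF f gens(1) a] mult[OF g gens(1) a] rot Suc by simp
  qed
  obtain a s where a: "x = (int a, s)" "a < m"
    using x that[of "nat (fst x)" "snd x"] by (auto simp: dihedral_def nat_less_iff)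
  show ?thesis
  proof (cases s)
    case False
    with a pow show ?thesis by simp
  next
    case True
    have c: "(int a, False) \<in> carrier (dihedral m)" using a by (simp add: dihedral_def)
    have "x = (int a, False) \<otimes>\<^bsub>dihedral m\<^esub> reflection"
      using a True by (simp add: reflection_def dihedral_def)
    then show ?thesis using mult[OF f c gens(2)] mult[OF g c gens(2)] ref pow[OF a(2)] by simp
  qed
qed

lemma faithful_standard_rep_eq:
  assumes "faithful_standard_rep m \<zeta> \<rho>" "m > 1" "\<zeta> ^ m = 1" "\<gamma> \<in> carrier (dihedral m)"
  shows "\<rho> \<gamma> = dihedral_mat 2 2 ((!) [\<zeta>, inverse \<zeta>]) \<gamma>"
proof -
  have "\<zeta> \<noteq> 0" using assms(2,3) by (metis power_0_left less_not_refl2 not_one_less_zero zero_neq_one)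
  interpret dihedral_weights 2 2 m "(!) [\<zeta>, inverse \<zeta>]"
    using assms(2,3)
    by unfold_locales (auto simp: pair_swap_def numeral_2_eq_2 less_Suc_eq power_inverse)
  show ?thesis
  proof (rule dihedral_hom_eqI[OF _ dihedral_mat_hom assms(2)])
    show "\<rho> \<in> hom (dihedral m) (GL 2)" using assms(1) by (simp add: faithful_standard_rep_def)
    show "\<rho> rotation = dihedral_mat 2 2 ((!) [\<zeta>, inverse \<zeta>]) rotation"
      "\<rho> reflection = dihedral_mat 2 2 ((!) [\<zeta>, inverse \<zeta>]) reflection"
      using assms(1)
      by (auto simp: faithful_standard_rep_def dihedral_mat_def monomial_mat_def rotation_def
          reflection_def pair_swap_def mat_of_rows_list_def numeral_2_eq_2 less_Suc_eq intro!: eq_matI)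
  qed (rule assms(4))
qed

lemma diag_block_standard_eq:
  "diag_block_mat [dihedral_mat 2 2 ((!) [a, b]) \<gamma>, dihedral_mat 2 2 ((!) [c, d]) \<gamma>, 1\<^sub>m 1] =
   dihedral_mat 5 4 ((!) [a, b, c, d, 1]) \<gamma>"
proof (rule eq_matI)
  obtain x s where \<gamma>: "\<gamma> = (x, s)" by (cases \<gamma>)
  fix i j
  assume "i < dim_row (dihedral_mat 5 4 ((!) [a, b, c, d, 1]) \<gamma>)"
    "j < dim_col (dihedral_mat 5 4 ((!) [a, b, c, d, 1]) \<gamma>)"
  then have "i \<in> {0, 1, 2, 3, 4}" "j \<in> {0, 1, 2, 3, 4}"
    by (auto simp: \<gamma> dihedral_mat_def monomial_mat_def)
  then show "diag_block_mat [dihedral_mat 2 2 ((!) [a, b]) \<gamma>, dihedral_mat 2 2 ((!) [c, d]) \<gamma>, 1\<^sub>m 1] $$ (i, j) =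
      dihedral_mat 5 4 ((!) [a, b, c, d, 1]) \<gamma> $$ (i, j)"
    by (auto simp: \<gamma> dihedral_mat_def monomial_mat_def pair_swap_def Let_def)
qed (auto simp: dihedral_mat_def monomial_mat_def Let_def split: prod.splits)

text \<open>The powers of \<open>z\<close> are \<open>m\<close> distinct roots of \<open>X\<^sup>m - 1\<close>, hence all of its roots.\<close>

lemma roots_of_unity_power:
  fixes z y :: "'k::field"
  assumes z: "primitive_root_of_unity m z" and m: "m > 0" and y: "y ^ m = 1"
  shows "\<exists>k<m. y = z ^ k"
proof -
  have z1: "z ^ m = 1" "\<And>k. 0 < k \<Longrightarrow> k < m \<Longrightarrow> z ^ k \<noteq> 1" using z by (auto simp: primitive_root_of_unity_def)
  have "z \<noteq> 0" using z1(1) m by (metis power_0_left less_not_refl2 zero_neq_one)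
  have "inj_on (\<lambda>k. z ^ k) {..<m}"
  proof (rule linorder_inj_onI')
    fix i j assume ij: "i \<in> {..<m}" "j \<in> {..<m}" "i < j"
    have "z ^ j = z ^ i * z ^ (j - i)" using ij by (simp flip: power_add)
    with ij z1(2)[of "j - i"] \<open>z \<noteq> 0\<close> show "z ^ i \<noteq> z ^ j" by auto
  qed
  then have card: "card ((\<lambda>k. z ^ k) ` {..<m}) = m" by (simp add: card_image)
  define P where "P = Polynomial.monom (1 :: 'k) m - 1"
  have P: "poly P x = x ^ m - 1" for x by (simp add: P_def poly_monom)
  have "P \<noteq> 0" using P[of 0] m by (auto simp: power_0_left)
  have "degree P \<le> m" unfolding P_def by (intro degree_diff_le) (simp_all add: degree_monom_le)
  then have fin: "finite {x. poly P x = 0}" and le: "card {x. poly P x = 0} \<le> m"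
    using \<open>P \<noteq> 0\<close> poly_roots_finite card_poly_roots_bound order_trans by blast+
  have "(\<lambda>k. z ^ k) ` {..<m} \<subseteq> {x. poly P x = 0}"
    using z1(1) by (auto simp: P simp flip: power_mult) (metis mult.commute power_mult power_one)
  with fin le card have "(\<lambda>k. z ^ k) ` {..<m} = {x. poly P x = 0}"
    by (metis card_seteq)
  then have "y \<in> (\<lambda>k. z ^ k) ` {..<m}" using y by (simp add: P)
  then show ?thesis by blast
qed

text \<open>Both roots of unity have \<open>m\<close>-th power \<open>- 1\<close>, so their quotient has \<open>m\<close>-th power \<open>1\<close> and is a
  power of the primitive \<open>m\<close>-th root \<open>\<zeta>\<^sup>2\<close>. The exponent gives the auxiliary representation
  \<open>R\<close>, on which the rotation acts by \<open>\<zeta>\<^sup>-\<^sup>k\<close> and \<open>\<zeta>\<^sup>k\<close>.\<close>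

lemma half_exponent:
  fixes \<zeta> \<zeta>' :: "'k::field"
  assumes \<zeta>: "primitive_root_of_unity (2 * m) \<zeta>" and \<zeta>': "primitive_root_of_unity (2 * m) \<zeta>'"
    and m: "m > 0"
  shows "\<exists>k<m. \<zeta> = \<zeta>' * (\<zeta> ^ k)\<^sup>2"
proof -
  have minus: "z ^ m = - 1" if "primitive_root_of_unity (2 * m) z" for z :: 'k
  proof -
    have "(z ^ m)\<^sup>2 = 1" "z ^ m \<noteq> 1"
      using that m by (auto simp: primitive_root_of_unity_def mult.commute simp flip: power_mult)
    then show ?thesis by (simp add: power2_eq_1_iff)
  qed
  have "\<zeta>' \<noteq> 0" using minus[OF \<zeta>'] m by (metis power_0_left less_not_refl2 neg_equal_0_iff_equal zero_neq_one)
  have "primitive_root_of_unity m (\<zeta>\<^sup>2)"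
    using \<zeta> by (auto simp: primitive_root_of_unity_def simp flip: power_mult)
  moreover have "(\<zeta> / \<zeta>') ^ m = 1"
    using minus[OF \<zeta>] minus[OF \<zeta>'] by (simp add: power_divide)
  ultimately obtain k where "k < m" "\<zeta> / \<zeta>' = (\<zeta>\<^sup>2) ^ k"
    using roots_of_unity_power[OF _ m] by blast
  with \<open>\<zeta>' \<noteq> 0\<close> show ?thesis
    by (intro exI[of _ k]) (simp add: field_simps flip: power_mult)
qed

section \<open>A birational map and its inverse\<close>

text \<open>Put \<open>M\<close> for the matrix with rows \<open>(x $ 0, x $ 2)\<close> and \<open>(x $ 3, x $ 1)\<close>, and let \<open>E\<close> be the matrix
  with rows \<open>(s v w, t v\<^sup>2)\<close> and \<open>(t w\<^sup>2, s v w)\<close>. Each entry of \<open>M E\<close> is a value of \<open>twist\<close>.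
  The vectors \<open>(v, w)\<close> and \<open>(v, - w)\<close> are eigenvectors of \<open>E\<close>, with eigenvalues
  \<open>(s + t) v w\<close> and \<open>(s - t) v w\<close>. So \<open>E\<close> is the operator that rescales the two lines determined
  by \<open>(v, w)\<close>, written without denominators.\<close>

definition twist :: "'k::field \<Rightarrow> 'k \<Rightarrow> 'k \<Rightarrow> 'k \<Rightarrow> 'k \<Rightarrow> 'k \<Rightarrow> 'k" where
  "twist s t v w a b = s * v * w * a + t * w\<^sup>2 * b"

text \<open>The determinant of the matrix \<open>M\<close>.\<close>

definition disc :: "'k::field vec \<Rightarrow> 'k" where
  "disc x = x $ 0 * x $ 1 - x $ 2 * x $ 3"

text \<open>The entries of \<open>M E\<close>, in the order of the coordinates.\<close>

definition twisted :: "'k::field \<Rightarrow> 'k \<Rightarrow> 'k \<Rightarrow> 'k \<Rightarrow> 'k vec \<Rightarrow> 'k list" where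
  "twisted s t v w x =
     [twist s t v w (x $ 0) (x $ 2), twist s t w v (x $ 1) (x $ 3),
      twist s t w v (x $ 2) (x $ 0), twist s t v w (x $ 3) (x $ 1)]"

text \<open>Two operators \<open>E\<close> for the same \<open>(v, w)\<close> commute; under the assumption their product is
  a scalar, so that the second twist undoes the first up to this scalar.\<close>

lemma twist_twist:
  assumes "s * t' + t * s' = 0"
  shows "twist s' t' v w (twist s t v w a b) (twist s t w v b a) = (s * s' + t * t') * (v * w)\<^sup>2 * a"
proof -
  have "twist s' t' v w (twist s t v w a b) (twist s t w v b a) =
      (s * s' + t * t') * (v * w)\<^sup>2 * a + (s * t' + t * s') * v * w ^ 3 * b"
    unfolding twist_def by (simp add: algebra_simps power2_eq_square power3_eq_cube)
  with assms show ?thesis by simp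
qed

text \<open>Multiplicativity of the determinant.\<close>

lemma twist_disc:
  "twist s t v w a c * twist s t w v b d - twist s t w v c a * twist s t v w d b =
   (a * b - c * d) * (s\<^sup>2 - t\<^sup>2) * (v * w)\<^sup>2"
  unfolding twist_def by (simp add: algebra_simps power2_eq_square)

lemma twist_scale:
  "twist s t (c * v) (c * w) a b = c\<^sup>2 * twist s t v w a b"
  "twist (c * s) (c * t) v w a b = c * twist s t v w a b"
  "twist s t v w (c * a) (c * b) = c * twist s t v w a b"
  unfolding twist_def by (simp_all add: algebra_simps power2_eq_square)

text \<open>Equivariance of \<open>E\<close> under the rotation, which acts on \<open>(v, w)\<close> by \<open>\<kappa>\<^sup>-\<^sup>1\<close> and \<open>\<kappa>\<close>.\<close>

lemma twist_weight:
  assumes "\<kappa> \<noteq> 0"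
  shows "\<alpha> = \<kappa>\<^sup>2 * \<beta> \<Longrightarrow> twist s t (inverse \<kappa> * v) (\<kappa> * w) (\<alpha> * a) (\<beta> * b) = \<alpha> * twist s t v w a b"
    and "\<beta> = \<kappa>\<^sup>2 * \<alpha> \<Longrightarrow> twist s t (\<kappa> * w) (inverse \<kappa> * v) (\<alpha> * a) (\<beta> * b) = \<alpha> * twist s t w v a b"
  using assms unfolding twist_def by (simp_all add: field_simps power2_eq_square)

text \<open>From \<open>(M, (v, w), h)\<close> with \<open>d = det M\<close>: rescaling the line of \<open>(v, w)\<close> by \<open>h\<^sup>2\<close> and the other one
  by \<open>d\<close> turns the determinant into a square, namely that of \<open>e\<close>, and so leads to a point
  \<open>y\<close> of the quadric. The four coordinates in the other factor are, up to a common
  multiple, the invariants \<open>h\<^sup>2\<close> and \<open>d\<close> and the coefficients of \<open>(v, w)\<close> with respect to the two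
  vectors \<open>(y\<^sub>1\<^sup>k, y\<^sub>0\<^sup>k)\<close> and \<open>(y\<^sub>0\<^sup>l, y\<^sub>1\<^sup>l)\<close>, found by Cramer's rule; \<open>D\<close> is the determinant of these
  vectors. The factor \<open>h\<close> and the powers of \<open>e\<close> only equalize the degrees.\<close>

definition from_linear :: "nat \<Rightarrow> nat \<Rightarrow> 'k::field vec list \<Rightarrow> 'k vec list" where
  "from_linear k l us =
    (let u = us ! 0; v = u $ 4; w = u $ 5; h = u $ 6; d = disc u;
         y = twisted (h\<^sup>2 + d) (h\<^sup>2 - d) v w u; e = 2 * v * w * h * d;
         D = (y ! 1) ^ (k + l) - (y ! 0) ^ (k + l)
     in [vec_of_list [y ! 0, y ! 1, y ! 2, y ! 3, e],
         vec_of_list [h\<^sup>2 * D, d * D, h * (v * (y ! 1) ^ l - w * (y ! 0) ^ l) * e ^ k,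
           h * (w * (y ! 1) ^ k - v * (y ! 0) ^ k) * e ^ l]])"

text \<open>The inverse: the vector \<open>(v, w)\<close> is rebuilt from its coefficients, and the rescaling of the second
  line is undone, the ratio of the two scaling factors being \<open>z $ 1 / z $ 0\<close>.\<close>

definition to_linear :: "nat \<Rightarrow> nat \<Rightarrow> 'k::field vec list \<Rightarrow> 'k vec list" where
  "to_linear k l xs =
    (let x = xs ! 0; z = xs ! 1; e = x $ 4;
         v = z $ 2 * e ^ l * (x $ 1) ^ k + z $ 3 * e ^ k * (x $ 0) ^ l;
         w = z $ 2 * e ^ l * (x $ 0) ^ k + z $ 3 * e ^ k * (x $ 1) ^ l;
         y = twisted (z $ 1 + z $ 0) (z $ 1 - z $ 0) v w x; r = 2 * v * w * e
     in [vec_of_list [e ^ (k + l) * y ! 0, e ^ (k + l) * y ! 1, e ^ (k + l) * y ! 2, e ^ (k + l) * y ! 3,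
           r * v, r * w, r * z $ 0 * e ^ (k + l)]])"

text \<open>The loci where this form and the next one do not vanish correspond to each other under the maps
  and carry the isomorphism.\<close>

definition from_linear_denom :: "nat \<Rightarrow> nat \<Rightarrow> 'k::field vec list \<Rightarrow> 'k" where
  "from_linear_denom k l us =
    (let u = us ! 0; v = u $ 4; w = u $ 5; h = u $ 6; d = disc u;
         y = twisted (h\<^sup>2 + d) (h\<^sup>2 - d) v w u
     in h * d * v * w * ((y ! 1) ^ (k + l) - (y ! 0) ^ (k + l)))"

definition to_linear_denom :: "nat \<Rightarrow> nat \<Rightarrow> 'k::field vec list \<Rightarrow> 'k" where
  "to_linear_denom k l xs =
    (let x = xs ! 0; z = xs ! 1; e = x $ 4;
         v = z $ 2 * e ^ l * (x $ 1) ^ k + z $ 3 * e ^ k * (x $ 0) ^ l;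
         w = z $ 2 * e ^ l * (x $ 0) ^ k + z $ 3 * e ^ k * (x $ 1) ^ l
     in e * z $ 0 * z $ 1 * ((x $ 1) ^ (k + l) - (x $ 0) ^ (k + l)) * v * w)"

lemma vec_of_list_eqI:
  assumes "dim_vec x = length as" "\<And>i. i < length as \<Longrightarrow> as ! i = c * x $ i"
  shows "vec_of_list as = c \<cdot>\<^sub>v x"
  using assms by (intro eq_vecI) (auto simp: vec_of_list_index)

text \<open>The coefficients found by Cramer's rule give back \<open>(v, w)\<close> up to the factor \<open>c\<close>, and the two
  rescalings cancel by \<open>twist_twist\<close>. The image lies on the quadric by \<open>twist_disc\<close>.\<close>

lemma to_linear_from_linear:
  fixes u :: "'k::field_char_0 vec"
  assumes u: "u \<in> carrier_vec 7" and nz: "from_linear_denom k l [u] \<noteq> 0"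
  shows "\<exists>c. c \<noteq> 0 \<and> to_linear k l (from_linear k l [u]) = [c \<cdot>\<^sub>v u]"
    and "to_linear_denom k l (from_linear k l [u]) \<noteq> 0"
    and "\<exists>x z. from_linear k l [u] = [x, z] \<and> x \<in> carrier_vec 5 \<and> x \<noteq> 0\<^sub>v 5 \<and> z \<in> carrier_vec 4 \<and> z \<noteq> 0\<^sub>v 4 \<and>
      x $ 0 * x $ 1 = x $ 2 * x $ 3 + (x $ 4)\<^sup>2"
proof -
  define v w h d where vwhd: "v = u $ 4" "w = u $ 5" "h = u $ 6" "d = disc u"
  define s t where st: "s = h\<^sup>2 + d" "t = h\<^sup>2 - d"
  define y0 y1 y2 y3 where y: "y0 = twist s t v w (u $ 0) (u $ 2)" "y1 = twist s t w v (u $ 1) (u $ 3)"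
    "y2 = twist s t w v (u $ 2) (u $ 0)" "y3 = twist s t v w (u $ 3) (u $ 1)"
  define e D where eD: "e = 2 * v * w * h * d" "D = y1 ^ (k + l) - y0 ^ (k + l)"
  define z2 z3 where z: "z2 = h * (v * y1 ^ l - w * y0 ^ l) * e ^ k" "z3 = h * (w * y1 ^ k - v * y0 ^ k) * e ^ l"
  define x z where xz: "x = vec_of_list [y0, y1, y2, y3, e]" "z = vec_of_list [h\<^sup>2 * D, d * D, z2, z3]"
  have F: "from_linear k l [u] = [x, z]"
    by (simp add: from_linear_def Let_def twisted_def xz z eD y st vwhd)
  have x: "x $ 0 = y0" "x $ 1 = y1" "x $ 2 = y2" "x $ 3 = y3" "x $ 4 = e"
    and z': "z $ 0 = h\<^sup>2 * D" "z $ 1 = d * D" "z $ 2 = z2" "z $ 3 = z3"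
    and car: "x \<in> carrier_vec 5" "z \<in> carrier_vec 4"
    by (simp_all add: xz vec_of_list_index carrier_vecI del: vec_of_list_Cons)
  have nz': "h \<noteq> 0" "d \<noteq> 0" "v \<noteq> 0" "w \<noteq> 0" "D \<noteq> 0"
    using nz by (auto simp: from_linear_denom_def Let_def twisted_def eD y st vwhd)
  then have e: "e \<noteq> 0" by (simp add: eD)
  define c where "c = h * e ^ (k + l) * D"
  have c: "c \<noteq> 0" using nz' e by (simp add: c_def)
  have vv: "z2 * e ^ l * y1 ^ k + z3 * e ^ k * y0 ^ l = c * v"
    and ww: "z2 * e ^ l * y0 ^ k + z3 * e ^ k * y1 ^ l = c * w"
    unfolding z c_def eD(2) by (simp_all add: algebra_simps power_add)
  have Q: "to_linear_denom k l [x, z] = e * (h\<^sup>2 * D) * (d * D) * D * (c * v) * (c * w)"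
    unfolding to_linear_denom_def Let_def by (simp add: x[unfolded One_nat_def] z'[unfolded One_nat_def] vv ww flip: eD(2))
  show "to_linear_denom k l (from_linear k l [u]) \<noteq> 0"
    unfolding F Q using nz' e c by simp
  have quad: "y0 * y1 - y2 * y3 = e\<^sup>2"
    unfolding y twist_disc disc_def[symmetric] vwhd(4)[symmetric] eD(1) st
    by (simp add: algebra_simps power2_eq_square)
  show "\<exists>x z. from_linear k l [u] = [x, z] \<and> x \<in> carrier_vec 5 \<and> x \<noteq> 0\<^sub>v 5 \<and> z \<in> carrier_vec 4 \<and> z \<noteq> 0\<^sub>v 4 \<and>
      x $ 0 * x $ 1 = x $ 2 * x $ 3 + (x $ 4)\<^sup>2"
  proof (intro exI conjI)
    show "x \<noteq> 0\<^sub>v 5" using e x(5) by auto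
    show "z \<noteq> 0\<^sub>v 4" using nz' z'(1) by auto
    show "x $ 0 * x $ 1 = x $ 2 * x $ 3 + (x $ 4)\<^sup>2" unfolding x using quad by (simp add: algebra_simps)
  qed (rule F car)+
  define r where "r = 2 * (c * v) * (c * w) * e"
  define s' t' where st': "s' = d * D + h\<^sup>2 * D" "t' = d * D - h\<^sup>2 * D"
  have "s * t' + t * s' = 0" unfolding st st' by (simp add: algebra_simps power2_eq_square)
  note tt = twist_twist[OF this]
  have ss: "e ^ (k + l) * (c\<^sup>2 * ((s * s' + t * t') * (v * w)\<^sup>2 * a)) = r * c * a" for a
  proof -
    have "s * s' + t * t' = 4 * D * h\<^sup>2 * d"
      unfolding st st' by (simp add: algebra_simps power2_eq_square)
    moreover have "2 * v * w * e * c = 2 * v * w * (2 * v * w * h * d) * (h * e ^ (k + l) * D)"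
      by (simp only: c_def flip: eD(1))
    ultimately have "e ^ (k + l) * (c\<^sup>2 * ((s * s' + t * t') * (v * w)\<^sup>2 * a)) = c\<^sup>2 * a * (2 * v * w * e * c)"
      by (auto simp add: algebra_simps power2_eq_square)
    then show ?thesis by (simp add: r_def algebra_simps power2_eq_square)
  qed
  have ss': "e ^ (k + l) * (c\<^sup>2 * ((s * s' + t * t') * (w * v)\<^sup>2 * a)) = r * c * a" for a
    using ss by (simp add: mult.commute)
  have hh: "r * (h\<^sup>2 * D) * e ^ (k + l) = r * c * h"
    unfolding c_def by (simp add: algebra_simps power2_eq_square)
  have "to_linear k l [x, z] = [vec_of_list [r * c * u $ 0, r * c * u $ 1, r * c * u $ 2, r * c * u $ 3,
      r * (c * v), r * (c * w), r * (h\<^sup>2 * D) * e ^ (k + l)]]"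
    unfolding to_linear_def Let_def twisted_def
    by (simp add: x[unfolded One_nat_def] z'[unfolded One_nat_def] vv ww flip: st' r_def) (simp add: y twist_scale tt ss ss')
  also have "\<dots> = [(r * c) \<cdot>\<^sub>v u]"
  proof -
    have "vec_of_list [r * c * u $ 0, r * c * u $ 1, r * c * u $ 2, r * c * u $ 3,
      r * (c * v), r * (c * w), r * (h\<^sup>2 * D) * e ^ (k + l)] = (r * c) \<cdot>\<^sub>v u"
    proof (rule vec_of_list_eqI)
      fix i assume "i < length [r * c * u $ 0, r * c * u $ 1, r * c * u $ 2, r * c * u $ 3,
        r * (c * v), r * (c * w), r * (h\<^sup>2 * D) * e ^ (k + l)]"
      then have "i \<in> {0, 1, 2, 3, 4, 5, 6}" by auto
      then show "[r * c * u $ 0, r * c * u $ 1, r * c * u $ 2, r * c * u $ 3,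
        r * (c * v), r * (c * w), r * (h\<^sup>2 * D) * e ^ (k + l)] ! i = r * c * u $ i"
        unfolding hh by (auto simp: vwhd)
    qed (use u in auto)
    then show ?thesis by simp
  qed
  finally show "\<exists>c. c \<noteq> 0 \<and> to_linear k l (from_linear k l [u]) = [c \<cdot>\<^sub>v u]"
    unfolding F using nz' e c by (intro exI[of _ "r * c"]) (auto simp: r_def)
qed

text \<open>On the quadric \<open>det M\<close> is the square of the last coordinate, so that \<open>h\<^sup>2\<close> and the determinant of
  the rebuilt matrix are in the ratio of \<open>z $ 0\<close> to \<open>z $ 1\<close>, with common factor \<open>g\<close>.\<close>

lemma from_linear_to_linear:
  fixes x z :: "'k::field_char_0 vec"
  assumes x: "x \<in> carrier_vec 5" and z: "z \<in> carrier_vec 4" and nz: "to_linear_denom k l [x, z] \<noteq> 0"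
    and quad: "x $ 0 * x $ 1 = x $ 2 * x $ 3 + (x $ 4)\<^sup>2"
  shows "\<exists>c c'. c \<noteq> 0 \<and> c' \<noteq> 0 \<and> from_linear k l (to_linear k l [x, z]) = [c \<cdot>\<^sub>v x, c' \<cdot>\<^sub>v z]"
    and "from_linear_denom k l (to_linear k l [x, z]) \<noteq> 0"
    and "\<exists>u. to_linear k l [x, z] = [u] \<and> u \<in> carrier_vec 7 \<and> u \<noteq> 0\<^sub>v 7"
proof -
  define e v w where evw: "e = x $ 4"
    "v = z $ 2 * e ^ l * (x $ 1) ^ k + z $ 3 * e ^ k * (x $ 0) ^ l"
    "w = z $ 2 * e ^ l * (x $ 0) ^ k + z $ 3 * e ^ k * (x $ 1) ^ l"
  define D where "D = (x $ 1) ^ (k + l) - (x $ 0) ^ (k + l)"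
  define s t where st: "s = z $ 1 + z $ 0" "t = z $ 1 - z $ 0"
  define r E where rE: "r = 2 * v * w * e" "E = e ^ (k + l)"
  define u0 u1 u2 u3 where u: "u0 = E * twist s t v w (x $ 0) (x $ 2)" "u1 = E * twist s t w v (x $ 1) (x $ 3)"
    "u2 = E * twist s t w v (x $ 2) (x $ 0)" "u3 = E * twist s t v w (x $ 3) (x $ 1)"
  define h where "h = r * z $ 0 * E"
  define u where "u = vec_of_list [u0, u1, u2, u3, r * v, r * w, h]"
  have G: "to_linear k l [x, z] = [u]"
    by (simp add: to_linear_def Let_def twisted_def u_def u rE h_def evw st)
  have uu: "u $ 0 = u0" "u $ 1 = u1" "u $ 2 = u2" "u $ 3 = u3" "u $ 4 = r * v" "u $ 5 = r * w" "u $ 6 = h"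
    and car: "u \<in> carrier_vec 7"
    by (simp_all add: u_def vec_of_list_index carrier_vecI del: vec_of_list_Cons)
  have nz': "e \<noteq> 0" "v \<noteq> 0" "w \<noteq> 0" "z $ 0 \<noteq> 0" "z $ 1 \<noteq> 0" "D \<noteq> 0"
    using nz by (auto simp: to_linear_denom_def Let_def evw D_def)
  then have r: "r \<noteq> 0" "E \<noteq> 0" by (auto simp: rE)
  then have h: "h \<noteq> 0" using nz' by (simp add: h_def)
  show "\<exists>u. to_linear k l [x, z] = [u] \<and> u \<in> carrier_vec 7 \<and> u \<noteq> 0\<^sub>v 7"
    using G car h uu(7) by (intro exI[of _ u]) auto
  define g where "g = r\<^sup>2 * E\<^sup>2 * z $ 0"
  have g: "g \<noteq> 0" using nz' r by (simp add: g_def)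
  have hg: "h\<^sup>2 = g * z $ 0" by (simp add: h_def g_def power2_eq_square)
  have d: "disc u = g * z $ 1"
  proof -
    have "disc u = E\<^sup>2 * ((x $ 0 * x $ 1 - x $ 2 * x $ 3) * (s\<^sup>2 - t\<^sup>2) * (v * w)\<^sup>2)"
      unfolding disc_def uu u twist_disc[symmetric] by (simp add: algebra_simps power2_eq_square)
    also have "x $ 0 * x $ 1 - x $ 2 * x $ 3 = e\<^sup>2" using quad by (simp add: evw)
    also have "E\<^sup>2 * (e\<^sup>2 * (s\<^sup>2 - t\<^sup>2) * (v * w)\<^sup>2) = g * z $ 1"
      unfolding g_def rE(1) st by (simp add: algebra_simps power2_eq_square)
    finally show ?thesis .
  qed
  define s' t' where st': "s' = z $ 0 + z $ 1" "t' = z $ 0 - z $ 1"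
  have st'': "h\<^sup>2 + disc u = g * s'" "h\<^sup>2 - disc u = g * t'"
    by (simp_all add: hg d st' algebra_simps)
  define c where "c = g * r\<^sup>2 * E * (4 * z $ 0 * z $ 1) * (v * w)\<^sup>2"
  have c: "c \<noteq> 0" using g r nz' by (simp add: c_def)
  have "s * t' + t * s' = 0" unfolding st st' by (simp add: algebra_simps power2_eq_square)
  note tt = twist_twist[OF this]
  have ss: "E * (r\<^sup>2 * (g * ((s * s' + t * t') * (v * w)\<^sup>2))) = c"
    "E * (r\<^sup>2 * (g * ((s * s' + t * t') * (w * v)\<^sup>2))) = c"
    unfolding st st' c_def by (simp_all add: algebra_simps power2_eq_square)
  have y: "twisted (h\<^sup>2 + disc u) (h\<^sup>2 - disc u) (r * v) (r * w) u = [c * x $ 0, c * x $ 1, c * x $ 2, c * x $ 3]"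
    unfolding st'' twisted_def uu u by (simp add: twist_scale tt ss)
  have ce: "2 * (r * v) * (r * w) * h * disc u = c * e"
    unfolding d c_def h_def g_def rE(1) by (simp add: algebra_simps power2_eq_square)
  define c' where "c' = g * c ^ (k + l) * D"
  have c': "c' \<noteq> 0" using c g nz' by (simp add: c'_def)
  have D: "(c * x $ 1) ^ (k + l) - (c * x $ 0) ^ (k + l) = c ^ (k + l) * D"
    by (simp add: D_def power_mult_distrib algebra_simps)
  have "from_linear_denom k l [u] = h * (g * z $ 1) * (r * v) * (r * w) * (c ^ (k + l) * D)"
    unfolding from_linear_denom_def Let_def nth_Cons_0 uu(5-7) y
    by (simp add: d D[unfolded One_nat_def])
  then show "from_linear_denom k l (to_linear k l [x, z]) \<noteq> 0"
    unfolding G using nz' r h g c by simp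
  have z2: "h * (r * v * (c * x $ 1) ^ l - r * w * (c * x $ 0) ^ l) * (c * e) ^ k = c' * z $ 2"
  proof -
    have "v * (x $ 1) ^ l - w * (x $ 0) ^ l = z $ 2 * e ^ l * D"
      unfolding evw D_def by (simp add: algebra_simps power_add)
    then have "h * (r * c ^ l * (v * (x $ 1) ^ l - w * (x $ 0) ^ l)) * (c * e) ^ k = c' * z $ 2"
      by (simp add: c'_def h_def g_def rE(2) power_mult_distrib power_add power2_eq_square)
    then show ?thesis by (simp add: power_mult_distrib algebra_simps)
  qed
  have z3: "h * (r * w * (c * x $ 1) ^ k - r * v * (c * x $ 0) ^ k) * (c * e) ^ l = c' * z $ 3"
  proof -
    have "w * (x $ 1) ^ k - v * (x $ 0) ^ k = z $ 3 * e ^ k * D"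
      unfolding evw D_def by (simp add: algebra_simps power_add)
    then have "h * (r * c ^ k * (w * (x $ 1) ^ k - v * (x $ 0) ^ k)) * (c * e) ^ l = c' * z $ 3"
      by (simp add: c'_def h_def g_def rE(2) power_mult_distrib power_add power2_eq_square)
    then show ?thesis by (simp add: power_mult_distrib algebra_simps)
  qed
  have "from_linear k l [u] = [vec_of_list [c * x $ 0, c * x $ 1, c * x $ 2, c * x $ 3, c * e],
      vec_of_list [g * z $ 0 * (c ^ (k + l) * D), g * z $ 1 * (c ^ (k + l) * D), c' * z $ 2, c' * z $ 3]]"
    unfolding from_linear_def Let_def by (simp add: uu y ce D[unfolded One_nat_def] z2[unfolded One_nat_def] z3[unfolded One_nat_def]) (simp add: hg d)
  also have "vec_of_list [c * x $ 0, c * x $ 1, c * x $ 2, c * x $ 3, c * e] = c \<cdot>\<^sub>v x"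
  proof (rule vec_of_list_eqI)
    fix i assume "i < length [c * x $ 0, c * x $ 1, c * x $ 2, c * x $ 3, c * e]"
    then have "i \<in> {0, 1, 2, 3, 4}" by auto
    then show "[c * x $ 0, c * x $ 1, c * x $ 2, c * x $ 3, c * e] ! i = c * x $ i"
      by (auto simp: evw)
  qed (use x in auto)
  also have "vec_of_list [g * z $ 0 * (c ^ (k + l) * D), g * z $ 1 * (c ^ (k + l) * D), c' * z $ 2, c' * z $ 3] = c' \<cdot>\<^sub>v z"
  proof (rule vec_of_list_eqI)
    fix i assume "i < length [g * z $ 0 * (c ^ (k + l) * D), g * z $ 1 * (c ^ (k + l) * D), c' * z $ 2, c' * z $ 3]"
    then have "i \<in> {0, 1, 2, 3}" by auto
    then show "[g * z $ 0 * (c ^ (k + l) * D), g * z $ 1 * (c ^ (k + l) * D), c' * z $ 2, c' * z $ 3] ! i = c' * z $ i"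
      by (auto simp: c'_def)
  qed (use z in auto)
  finally show "\<exists>c c'. c \<noteq> 0 \<and> c' \<noteq> 0 \<and> from_linear k l (to_linear k l [x, z]) = [c \<cdot>\<^sub>v x, c' \<cdot>\<^sub>v z]"
    unfolding G using c c' by blast
qed

section \<open>Equivariance of the birational map\<close>

definition linear_rot :: "'k::field \<Rightarrow> 'k \<Rightarrow> 'k \<Rightarrow> 'k vec \<Rightarrow> 'k vec" where
  "linear_rot \<omega> \<omega>' \<kappa> u = vec_of_list
     [\<omega> * u $ 0, inverse \<omega> * u $ 1, \<omega>' * u $ 2, inverse \<omega>' * u $ 3, inverse \<kappa> * u $ 4, \<kappa> * u $ 5, u $ 6]"

definition linear_flip :: "'k::field vec \<Rightarrow> 'k vec" where
  "linear_flip u = vec_of_list [u $ 1, u $ 0, u $ 3, u $ 2, u $ 5, u $ 4, u $ 6]"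

definition quadric_rot :: "'k::field \<Rightarrow> 'k \<Rightarrow> 'k vec \<Rightarrow> 'k vec" where
  "quadric_rot \<omega> \<omega>' x = vec_of_list
     [\<omega> * x $ 0, inverse \<omega> * x $ 1, \<omega>' * x $ 2, inverse \<omega>' * x $ 3, x $ 4]"

definition quadric_flip :: "'k::field vec \<Rightarrow> 'k vec" where
  "quadric_flip x = vec_of_list [x $ 1, x $ 0, x $ 3, x $ 2, x $ 4]"

text \<open>The quadric coordinates inherit the weights of \<open>M\<close> because \<open>E\<close> is equivariant. The coordinates
  in the second factor are invariant: by \<open>\<kappa> = \<omega>\<^sup>k = \<omega>\<^sup>-\<^sup>l\<close> the two vectors of powers transform like \<open>(v, w)\<close>,
  so that its coefficients with respect to them do not change.\<close>

lemma from_linear_rot: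
  assumes nz: "\<omega> \<noteq> 0" "\<omega>' \<noteq> 0" and \<kappa>: "\<kappa> = \<omega> ^ k" "\<omega> ^ (k + l) = 1" "\<omega> = \<kappa>\<^sup>2 * \<omega>'"
    and F: "from_linear k l [u] = [x, z]"
  shows "from_linear k l [linear_rot \<omega> \<omega>' \<kappa> u] = [quadric_rot \<omega> \<omega>' x, z]"
proof -
  have \<kappa>0: "\<kappa> \<noteq> 0" using \<kappa>(1) nz(1) by simp
  define u' where "u' = linear_rot \<omega> \<omega>' \<kappa> u"
  have u': "u' $ 0 = \<omega> * u $ 0" "u' $ 1 = inverse \<omega> * u $ 1" "u' $ 2 = \<omega>' * u $ 2" "u' $ 3 = inverse \<omega>' * u $ 3"
    "u' $ 4 = inverse \<kappa> * u $ 4" "u' $ 5 = \<kappa> * u $ 5" "u' $ 6 = u $ 6"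
    by (simp_all add: u'_def linear_rot_def vec_of_list_index del: vec_of_list_Cons)
  have d: "disc u' = disc u" using nz by (simp add: disc_def u'[unfolded One_nat_def] field_simps)
  have inv: "inverse \<omega>' = \<kappa>\<^sup>2 * inverse \<omega>" "\<omega> = \<kappa>\<^sup>2 * \<omega>'"
    using nz \<kappa>(3) \<kappa>0 by (simp_all add: field_simps)
  have y: "twisted s t (u' $ 4) (u' $ 5) u' =
      [\<omega> * (twisted s t (u $ 4) (u $ 5) u ! 0), inverse \<omega> * (twisted s t (u $ 4) (u $ 5) u ! 1),
       \<omega>' * (twisted s t (u $ 4) (u $ 5) u ! 2), inverse \<omega>' * (twisted s t (u $ 4) (u $ 5) u ! 3)]" for s t
    unfolding twisted_def u'
    using twist_weight(1)[OF \<kappa>0 inv(2)] twist_weight(1)[OF \<kappa>0 inv(1)]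
      twist_weight(2)[OF \<kappa>0 inv(1)] twist_weight(2)[OF \<kappa>0 inv(2)] by simp
  have l: "\<omega> ^ l = inverse \<kappa>"
    using \<kappa>(1,2) \<kappa>0 by (simp add: power_add field_simps)
  have K: "(\<omega> * a) ^ (k + l) = a ^ (k + l)" "(inverse \<omega> * a) ^ (k + l) = a ^ (k + l)" for a
    using \<kappa>(2) by (simp_all only: power_mult_distrib power_inverse mult_1 inverse_1)
  have kl: "(\<omega> * a) ^ k = \<kappa> * a ^ k" "(\<omega> * a) ^ l = inverse \<kappa> * a ^ l"
    "(inverse \<omega> * a) ^ k = inverse \<kappa> * a ^ k" "(inverse \<omega> * a) ^ l = \<kappa> * a ^ l" for a
    using l \<kappa>(1) by (simp_all add: power_mult_distrib power_inverse)
  have e: "2 * u' $ 4 * u' $ 5 = 2 * u $ 4 * u $ 5"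
    using \<kappa>0 by (simp add: u')
  have can: "inverse \<kappa> * a * (\<kappa> * b) - \<kappa> * c * (inverse \<kappa> * f) = a * b - c * f"
    "\<kappa> * c * (inverse \<kappa> * f) - inverse \<kappa> * a * (\<kappa> * b) = c * f - a * b" for a b c f
    using \<kappa>0 by (simp_all add: field_simps)
  have xz: "x = hd (from_linear k l [u])" "z = hd (tl (from_linear k l [u]))" using F by simp_all
  have "from_linear k l [u'] = [quadric_rot \<omega> \<omega>' x, z]"
    unfolding xz from_linear_def Let_def list.sel nth_Cons_0 d u'(7) y e quadric_rot_def
    by (simp add: u'(5,6) can K[unfolded One_nat_def] kl vec_of_list_index del: vec_of_list_Cons)
  then show ?thesis by (simp add: u'_def)
qed

text \<open>The reflection exchanges the two components of all three vectors in Cramer's rule, which changes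
  the sign of every determinant in it and thus gives the same point.\<close>

lemma from_linear_flip:
  assumes F: "from_linear k l [u] = [x, z]"
  shows "from_linear k l [linear_flip u] = [quadric_flip x, (- 1) \<cdot>\<^sub>v z]"
proof -
  define u' where "u' = linear_flip u"
  have u': "u' $ 0 = u $ 1" "u' $ 1 = u $ 0" "u' $ 2 = u $ 3" "u' $ 3 = u $ 2"
    "u' $ 4 = u $ 5" "u' $ 5 = u $ 4" "u' $ 6 = u $ 6"
    by (simp_all add: u'_def linear_flip_def vec_of_list_index del: vec_of_list_Cons)
  have d: "disc u' = disc u" by (simp add: disc_def u'[unfolded One_nat_def])
  have y: "twisted s t (u' $ 4) (u' $ 5) u' =
      [twisted s t (u $ 4) (u $ 5) u ! 1, twisted s t (u $ 4) (u $ 5) u ! 0,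
       twisted s t (u $ 4) (u $ 5) u ! 3, twisted s t (u $ 4) (u $ 5) u ! 2]" for s t
    unfolding twisted_def u' by simp
  have e: "2 * u' $ 4 * u' $ 5 = 2 * u $ 4 * u $ 5" by (simp add: u')
  have neg: "vec_of_list [a, b, c, f] = (- 1) \<cdot>\<^sub>v vec_of_list [a', b', c', f']"
    if "a = - a'" "b = - b'" "c = - c'" "f = - f'" for a b c f a' b' c' f' :: 'a
  proof (rule vec_of_list_eqI)
    fix i assume "i < length [a, b, c, f]"
    then have "i \<in> {0, 1, 2, 3}" by auto
    then show "[a, b, c, f] ! i = - 1 * vec_of_list [a', b', c', f'] $ i"
      using that by (auto simp: vec_of_list_index simp del: vec_of_list_Cons)
  qed simp
  have xz: "x = hd (from_linear k l [u])" "z = hd (tl (from_linear k l [u]))" using F by simp_all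
  have "from_linear k l [u'] = [quadric_flip x, (- 1) \<cdot>\<^sub>v z]"
    unfolding xz from_linear_def Let_def list.sel nth_Cons_0 d u'(7) y e quadric_flip_def
    by (intro arg_cong2[of _ _ _ _ "\<lambda>a b. [a, b]"] neg)
       (simp_all add: u'(5,6) vec_of_list_index algebra_simps del: vec_of_list_Cons)
  then show ?thesis by (simp add: u'_def)
qed

lemma dihedral_mat_linear:
  assumes "u \<in> carrier_vec 7"
  shows "dihedral_mat 7 6 ((!) [\<alpha>, inverse \<alpha>, \<alpha>', inverse \<alpha>', inverse \<beta>, \<beta>, 1]) (a, s) *\<^sub>v u =
    linear_rot (\<alpha> powi a) (\<alpha>' powi a) (\<beta> powi a) (if s then linear_flip u else u)" (is "?A *\<^sub>v u = ?r")
proof (rule eq_vecI)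
  fix i assume "i < dim_vec ?r"
  then have "i \<in> {0, 1, 2, 3, 4, 5, 6}" by (auto simp: linear_rot_def)
  then show "(?A *\<^sub>v u) $ i = ?r $ i"
    using assms unfolding dihedral_mat_def prod.case
    by (auto simp: monomial_mat_mult_vec pair_swap_def linear_rot_def linear_flip_def vec_of_list_index
        power_int_inverse simp del: vec_of_list_Cons)
qed (simp add: dihedral_mat_def monomial_mat_def linear_rot_def)

lemma dihedral_mat_quadric:
  assumes "x \<in> carrier_vec 5"
  shows "dihedral_mat 5 4 ((!) [\<alpha>, inverse \<alpha>, \<alpha>', inverse \<alpha>', 1]) (a, s) *\<^sub>v x =
    quadric_rot (\<alpha> powi a) (\<alpha>' powi a) (if s then quadric_flip x else x)" (is "?A *\<^sub>v x = ?r")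
proof (rule eq_vecI)
  fix i assume "i < dim_vec ?r"
  then have "i \<in> {0, 1, 2, 3, 4}" by (auto simp: quadric_rot_def)
  then show "(?A *\<^sub>v x) $ i = ?r $ i"
    using assms unfolding dihedral_mat_def prod.case
    by (auto simp: monomial_mat_mult_vec pair_swap_def quadric_rot_def quadric_flip_def vec_of_list_index
        power_int_inverse simp del: vec_of_list_Cons)
qed (simp add: dihedral_mat_def monomial_mat_def quadric_rot_def)

section \<open>The birational maps are given by multihomogeneous polynomials\<close>

lemma hom_fun_degree_cong:
  "hom_fun ds d \<phi> \<Longrightarrow> (\<And>i. i < length ds \<Longrightarrow> d i = e i) \<Longrightarrow> hom_fun ds e \<phi>"
  unfolding hom_fun_def multihomogeneous_def by auto

text \<open>Rules that compute a degree from the structure of an expression; equality of the degrees of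
  two summands is left as a side condition, to be decided once both degrees are known.\<close>

lemma hom_fun_add_infer:
  "hom_fun ds d \<phi> \<Longrightarrow> hom_fun ds e \<psi> \<Longrightarrow> (\<And>i. i < length ds \<Longrightarrow> d i = e i) \<Longrightarrow>
   hom_fun ds d (\<lambda>vs. \<phi> vs + \<psi> vs)"
  by (metis hom_fun_add hom_fun_degree_cong)

lemma hom_fun_diff_infer:
  "hom_fun ds d \<phi> \<Longrightarrow> hom_fun ds e \<psi> \<Longrightarrow> (\<And>i. i < length ds \<Longrightarrow> d i = e i) \<Longrightarrow>
   hom_fun ds d (\<lambda>vs. \<phi> vs - \<psi> vs)"
  by (metis hom_fun_diff hom_fun_degree_cong)

lemma hom_fun_mult_infer:
  "hom_fun ds d \<phi> \<Longrightarrow> hom_fun ds e \<psi> \<Longrightarrow> hom_fun ds (\<lambda>i. d i + e i) (\<lambda>vs. \<phi> vs * \<psi> vs)"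
  by (rule hom_fun_mult) auto

lemma hom_fun_power_infer:
  "hom_fun ds d \<phi> \<Longrightarrow> hom_fun ds (\<lambda>i. n * d i) (\<lambda>vs. \<phi> vs ^ n)"
  by (rule hom_fun_power) auto

lemmas hom_fun_intros =
  hom_fun_coord hom_fun_const hom_fun_add_infer hom_fun_diff_infer hom_fun_mult_infer hom_fun_power_infer

lemma hom_mapI:
  assumes F: "\<And>vs. F vs = map (\<lambda>fs. vec_of_list (map (\<lambda>f. f vs) fs)) fss"
    and len: "length fss = length es" "\<And>i. i < length es \<Longrightarrow> length (fss ! i) = Suc (es ! i)"
    and hom: "\<And>i. i < length es \<Longrightarrow> \<exists>d. \<forall>f\<in>set (fss ! i). hom_fun ds d f"
  shows "hom_map ds es F"
  unfolding hom_map_def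
proof (intro conjI allI impI)
  fix vs i assume "i < length es"
  then show "F vs ! i \<in> carrier_vec (Suc (es ! i))" using len by (auto simp: F intro!: carrier_vecI)
next
  fix i assume i: "i < length es"
  obtain d where d: "\<And>f. f \<in> set (fss ! i) \<Longrightarrow> hom_fun ds d f" using hom[OF i] by blast
  have "(\<lambda>vs. F vs ! i $ j) = fss ! i ! j" if "j \<le> es ! i" for j
    using that i len by (auto simp: F vec_of_list_index)
  then have "hom_fun ds d (\<lambda>vs. F vs ! i $ j)" if "j \<le> es ! i" for j
    using d that i len by simp
  then show "\<exists>d. \<forall>j\<le>es ! i. hom_fun ds d (\<lambda>vs. F vs ! i $ j)" by blast
qed (use len in \<open>simp add: F\<close>)

lemma
  fixes k l :: nat
  shows hom_map_from_linear: "hom_map [6] [4, 3] (from_linear k l :: 'k::field vec list \<Rightarrow> _)"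
    and hom_fun_from_linear_denom:
      "hom_fun [6] (\<lambda>_. 5 * (k + l) + 5) (from_linear_denom k l :: 'k vec list \<Rightarrow> _)"
proof -
  define v w h d :: "'k vec list \<Rightarrow> 'k" where vwhd: "v = (\<lambda>us. us ! 0 $ 4)" "w = (\<lambda>us. us ! 0 $ 5)"
    "h = (\<lambda>us. us ! 0 $ 6)" "d = (\<lambda>us. disc (us ! 0))"
  define y where "y i us = twisted ((h us)\<^sup>2 + d us) ((h us)\<^sup>2 - d us) (v us) (w us) (us ! 0) ! i" for i us
  define e where "e us = 2 * v us * w us * h us * d us" for us
  define D where "D us = y 1 us ^ (k + l) - y 0 us ^ (k + l)" for us
  have coord: "hom_fun [6] (\<lambda>_. 1) (\<lambda>us. us ! 0 $ j :: 'k)" if "j \<le> 6" for j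
    by (rule hom_fun_degree_cong, rule hom_fun_coord) (use that in auto)
  have hv: "hom_fun [6] (\<lambda>_. 1) v" "hom_fun [6] (\<lambda>_. 1) w" "hom_fun [6] (\<lambda>_. 1) h"
    using coord[of 4] coord[of 5] coord[of 6] unfolding vwhd by simp_all
  have hd: "hom_fun [6] (\<lambda>_. 2) d"
    unfolding vwhd disc_def by (rule hom_fun_degree_cong) (rule hom_fun_intros | fastforce)+
  note base = hv hd
  have hy: "hom_fun [6] (\<lambda>_. 5) (y i)" if i: "i < 4" for i
  proof -
    consider "i = 0" | "i = 1" | "i = 2" | "i = 3" using i by linarith
    then show ?thesis
    proof cases
    qed (simp_all add: y_def[abs_def] twisted_def twist_def,
      (rule hom_fun_degree_cong, (rule hom_fun_intros base | fastforce)+)+)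
  qed
  have he: "hom_fun [6] (\<lambda>_. 5) e"
    unfolding e_def by (rule hom_fun_degree_cong) (rule hom_fun_intros base | fastforce)+
  have hD: "hom_fun [6] (\<lambda>_. 5 * (k + l)) D"
    unfolding D_def by (rule hom_fun_degree_cong) (rule hom_fun_intros hy | fastforce)+
  show "hom_map [6] [4, 3] (from_linear k l :: 'k vec list \<Rightarrow> _)"
  proof (rule hom_mapI)
    show "from_linear k l us = map (\<lambda>fs. vec_of_list (map (\<lambda>f. f us) fs))
      [[y 0, y 1, y 2, y 3, e],
       [\<lambda>us. (h us)\<^sup>2 * D us, \<lambda>us. d us * D us,
        \<lambda>us. h us * (v us * y 1 us ^ l - w us * y 0 us ^ l) * e us ^ k,
        \<lambda>us. h us * (w us * y 1 us ^ k - v us * y 0 us ^ k) * e us ^ l]]" for us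
      by (simp add: from_linear_def Let_def y_def e_def D_def vwhd del: vec_of_list_map)
    fix i assume "i < length [4, 3 :: nat]"
    then consider "i = 0" | "i = 1" by (auto simp: less_Suc_eq)
    then show "\<exists>deg. \<forall>f\<in>set ([[y 0, y 1, y 2, y 3, e],
       [\<lambda>us. (h us)\<^sup>2 * D us, \<lambda>us. d us * D us,
        \<lambda>us. h us * (v us * y 1 us ^ l - w us * y 0 us ^ l) * e us ^ k,
        \<lambda>us. h us * (w us * y 1 us ^ k - v us * y 0 us ^ k) * e us ^ l]] ! i). hom_fun [6] deg f"
    proof cases
      case 1
      with hy he show ?thesis by (intro exI[of _ "\<lambda>_. 5"]) auto
    next
      case 2
      have h1: "hom_fun [6] (\<lambda>_. 5 * (k + l) + 2) (\<lambda>us. (h us)\<^sup>2 * D us)"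
        by (rule hom_fun_degree_cong) (rule hom_fun_intros base hy he hD | fastforce)+
      have h2: "hom_fun [6] (\<lambda>_. 5 * (k + l) + 2) (\<lambda>us. d us * D us)"
        by (rule hom_fun_degree_cong) (rule hom_fun_intros base hy he hD | fastforce)+
      have h3: "hom_fun [6] (\<lambda>_. 5 * (k + l) + 2) (\<lambda>us. h us * (v us * y 1 us ^ l - w us * y 0 us ^ l) * e us ^ k)"
        by (rule hom_fun_degree_cong) (rule hom_fun_intros base hy he hD | fastforce)+
      have h4: "hom_fun [6] (\<lambda>_. 5 * (k + l) + 2) (\<lambda>us. h us * (w us * y 1 us ^ k - v us * y 0 us ^ k) * e us ^ l)"
        by (rule hom_fun_degree_cong) (rule hom_fun_intros base hy he hD | fastforce)+
      with h1 h2 h3 h4 2 show ?thesis by (intro exI[of _ "\<lambda>_. 5 * (k + l) + 2"]) simp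
    qed
  qed (auto simp: less_Suc_eq)
  have "from_linear_denom k l = (\<lambda>us. h us * d us * v us * w us * D us)"
    by (simp add: from_linear_denom_def Let_def y_def D_def vwhd fun_eq_iff)
  moreover have "hom_fun [6] (\<lambda>_. 5 * (k + l) + 5) (\<lambda>us. h us * d us * v us * w us * D us)"
    by (rule hom_fun_degree_cong) (rule hom_fun_intros base hD | fastforce)+
  ultimately show "hom_fun [6] (\<lambda>_. 5 * (k + l) + 5) (from_linear_denom k l :: 'k vec list \<Rightarrow> _)" by simp
qed

lemma
  fixes k l :: nat
  shows hom_map_to_linear: "hom_map [4, 3] [6] (to_linear k l :: 'k::field vec list \<Rightarrow> _)"
    and hom_fun_to_linear_denom:
      "hom_fun [4, 3] (\<lambda>i. if i = 0 then 3 * (k + l) + 1 else 4) (to_linear_denom k l :: 'k vec list \<Rightarrow> _)"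
proof -
  define x z :: "nat \<Rightarrow> 'k vec list \<Rightarrow> 'k" where xz: "x = (\<lambda>i xs. xs ! 0 $ i)" "z = (\<lambda>i xs. xs ! 1 $ i)"
  define v where "v xs = z 2 xs * x 4 xs ^ l * x 1 xs ^ k + z 3 xs * x 4 xs ^ k * x 0 xs ^ l" for xs
  define w where "w xs = z 2 xs * x 4 xs ^ l * x 0 xs ^ k + z 3 xs * x 4 xs ^ k * x 1 xs ^ l" for xs
  define y where "y i xs = twisted (z 1 xs + z 0 xs) (z 1 xs - z 0 xs) (v xs) (w xs) (xs ! 0) ! i" for i xs
  define r where "r xs = 2 * v xs * w xs * x 4 xs" for xs
  define bideg :: "nat \<Rightarrow> nat \<Rightarrow> nat \<Rightarrow> nat" where "bideg a b = (\<lambda>i. if i = 0 then a else b)" for a b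
  have bideg: "bideg a b 0 = a" "bideg a b (Suc j) = b" for a b j by (simp_all add: bideg_def)
  have hx: "hom_fun [4, 3] (bideg 1 0) (x i)" if "i \<le> 4" for i
    unfolding xz
    by (rule hom_fun_degree_cong, rule hom_fun_coord) (use that in \<open>auto simp: less_Suc_eq bideg\<close>)
  have hz: "hom_fun [4, 3] (bideg 0 1) (z i)" if "i \<le> 3" for i
    unfolding xz
    by (rule hom_fun_degree_cong, rule hom_fun_coord) (use that in \<open>auto simp: less_Suc_eq bideg\<close>)
  have hv: "hom_fun [4, 3] (bideg (k + l) 1) v"
    unfolding v_def by (rule hom_fun_degree_cong) (rule hom_fun_intros hx hz | fastforce simp: less_Suc_eq bideg)+
  have hw: "hom_fun [4, 3] (bideg (k + l) 1) w"
    unfolding w_def by (rule hom_fun_degree_cong) (rule hom_fun_intros hx hz | fastforce simp: less_Suc_eq bideg)+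
  note hvw = hv hw
  have hy: "hom_fun [4, 3] (bideg (2 * (k + l) + 1) 3) (y i)" if i: "i < 4" for i
  proof -
    consider "i = 0" | "i = 1" | "i = 2" | "i = 3" using i by linarith
    then show ?thesis
    proof cases
    qed (simp_all add: y_def[abs_def] twisted_def twist_def fun_cong[OF xz(1), symmetric],
      (rule hom_fun_degree_cong, (rule hom_fun_intros hx hz hvw | fastforce simp: less_Suc_eq bideg)+)+)
  qed
  have hr: "hom_fun [4, 3] (bideg (2 * (k + l) + 1) 2) r"
    unfolding r_def by (rule hom_fun_degree_cong) (rule hom_fun_intros hx hvw | fastforce simp: less_Suc_eq bideg)+
  let ?fs = "[\<lambda>xs. x 4 xs ^ (k + l) * y 0 xs, \<lambda>xs. x 4 xs ^ (k + l) * y 1 xs,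
    \<lambda>xs. x 4 xs ^ (k + l) * y 2 xs, \<lambda>xs. x 4 xs ^ (k + l) * y 3 xs,
    \<lambda>xs. r xs * v xs, \<lambda>xs. r xs * w xs, \<lambda>xs. r xs * z 0 xs * x 4 xs ^ (k + l)]"
  show "hom_map [4, 3] [6] (to_linear k l :: 'k vec list \<Rightarrow> _)"
  proof (rule hom_mapI)
    show "to_linear k l xs = map (\<lambda>fs. vec_of_list (map (\<lambda>f. f xs) fs)) [?fs]" for xs
      by (simp add: to_linear_def Let_def y_def r_def v_def w_def xz del: vec_of_list_map)
    fix i assume "i < length [6 :: nat]"
    then have "i = 0" by simp
    have "\<forall>f\<in>set ?fs. hom_fun [4, 3] (bideg (3 * (k + l) + 1) 3) f"
    proof
      fix f assume "f \<in> set ?fs"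
      then show "hom_fun [4, 3] (bideg (3 * (k + l) + 1) 3) f"
        unfolding set_simps insert_iff empty_iff
      by (elim disjE; hypsubst?)
         (rule hom_fun_degree_cong, (rule hom_fun_intros hx hz hvw hy hr | fastforce simp: less_Suc_eq bideg)+)+
    qed
    then show "\<exists>d. \<forall>f\<in>set ([?fs] ! i). hom_fun [4, 3] d f"
      unfolding \<open>i = 0\<close> nth_Cons_0
      by (intro exI[of _ "bideg (3 * (k + l) + 1) 3"])
  qed (auto simp: less_Suc_eq)
  have "to_linear_denom k l =
      (\<lambda>xs. x 4 xs * z 0 xs * z 1 xs * (x 1 xs ^ (k + l) - x 0 xs ^ (k + l)) * v xs * w xs)"
    by (simp add: to_linear_denom_def Let_def v_def w_def xz fun_eq_iff)
  moreover have "hom_fun [4, 3] (\<lambda>i. if i = 0 then 3 * (k + l) + 1 else 4)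
      (\<lambda>xs. x 4 xs * z 0 xs * z 1 xs * (x 1 xs ^ (k + l) - x 0 xs ^ (k + l)) * v xs * w xs)"
    by (rule hom_fun_degree_cong) (rule hom_fun_intros hx hz hvw | fastforce simp: less_Suc_eq bideg)+
  ultimately show "hom_fun [4, 3] (\<lambda>i. if i = 0 then 3 * (k + l) + 1 else 4)
      (to_linear_denom k l :: 'k vec list \<Rightarrow> _)" by simp
qed

section \<open>Density in projective space and in the quadric\<close>

lemma valid_single: "valid [n] vs \<longleftrightarrow> (\<exists>u. vs = [u] \<and> u \<in> carrier_vec (Suc n) \<and> u \<noteq> 0\<^sub>v (Suc n))"
  by (auto simp: valid_def length_Suc_conv)

lemma valid_pair: "valid [n, m] vs \<longleftrightarrow> (\<exists>x z. vs = [x, z] \<and>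
    x \<in> carrier_vec (Suc n) \<and> x \<noteq> 0\<^sub>v (Suc n) \<and> z \<in> carrier_vec (Suc m) \<and> z \<noteq> 0\<^sub>v (Suc m))"
  by (auto simp: valid_def length_Suc_conv less_Suc_eq)

definition segment :: "nat \<Rightarrow> 'k::field vec \<Rightarrow> 'k vec \<Rightarrow> 'k \<Rightarrow> 'k vec" where
  "segment n u v t = vec n (\<lambda>j. (1 - t) * u $ j + t * v $ j)"

lemma segment_simps:
  assumes "u \<in> carrier_vec n" "v \<in> carrier_vec n"
  shows "segment n u v t \<in> carrier_vec n" "segment n u v 0 = u" "segment n u v 1 = v"
  using assms by (auto simp: segment_def)

lemma is_poly_segment: "j \<le> n \<Longrightarrow> is_poly (\<lambda>t. segment (Suc n) u v t $ j)"
  by (simp add: segment_def) (intro is_poly_intros)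

text \<open>Any two points are joined by a line.\<close>

lemma dense_open_proj_space:
  fixes \<phi> :: "'k::field_char_0 vec list \<Rightarrow> 'k"
  assumes \<phi>: "hom_fun [n] d \<phi>" and w: "valid [n] [w]" "\<phi> [w] \<noteq> 0"
  shows "dense_open [n] (mproj [n]) (mproj [n] \<inter> nonvanish [n] \<phi>)"
proof (rule dense_open_nonvanish[OF \<phi> order_refl])
  fix vs :: "'k vec list" assume "valid [n] vs"
  then obtain u where u: "vs = [u]" "u \<in> carrier_vec (Suc n)" by (auto simp: valid_single)
  have w': "w \<in> carrier_vec (Suc n)" using w by (simp add: valid_def)
  define c where "c t = [segment (Suc n) u w t]" for t
  have "curve [n] c"
    by (auto simp: curve_def c_def segment_simps[OF u(2) w'] is_poly_segment)
  moreover have "c 0 = vs" "c 1 = [w]" by (simp_all add: c_def u segment_simps[OF u(2) w'])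
  moreover have "pt [w] \<in> nonvanish [n] \<phi>" using w unfolding nonvanish_def by blast
  ultimately show "\<exists>c t0 t1. curve [n] c \<and> pt (c t0) = pt vs \<and> pt (c t1) \<in> nonvanish [n] \<phi> \<and>
        (\<forall>t. valid [n] (c t) \<longrightarrow> pt (c t) \<in> mproj [n])"
    by (intro exI[of _ c] exI[of _ 0] exI[of _ 1]) (auto simp: mem_mproj)
qed

definition on_quadric :: "'k::field vec \<Rightarrow> bool" where
  "on_quadric x \<longleftrightarrow> x $ 0 * x $ 1 = x $ 2 * x $ 3 + (x $ 4)\<^sup>2"

lemma mem_quadric_times_proj:
  "p \<in> times_proj quadric m \<longleftrightarrow> (\<exists>x z. valid [4, m] [x, z] \<and> on_quadric x \<and> p = pt [x, z])"
proof -
  have on: "(\<forall>v\<in>proj_pt x. v $ 0 * v $ 1 = v $ 2 * v $ 3 + (v $ 4)\<^sup>2) \<longleftrightarrow> on_quadric x"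
    if x: "x \<in> carrier_vec 5" for x :: "'a vec"
  proof
    assume "\<forall>v\<in>proj_pt x. v $ 0 * v $ 1 = v $ 2 * v $ 3 + (v $ 4)\<^sup>2"
    moreover have "x \<in> proj_pt x" unfolding proj_pt_def by (auto intro!: exI[of _ 1])
    ultimately show "on_quadric x" by (simp add: on_quadric_def)
  next
    assume q: "on_quadric x"
    show "\<forall>v\<in>proj_pt x. v $ 0 * v $ 1 = v $ 2 * v $ 3 + (v $ 4)\<^sup>2"
    proof
      fix v assume "v \<in> proj_pt x"
      then obtain c where "v = c \<cdot>\<^sub>v x" by (auto simp: proj_pt_def)
      then have "v $ 0 * v $ 1 - (v $ 2 * v $ 3 + (v $ 4)\<^sup>2) =
          c\<^sup>2 * (x $ 0 * x $ 1 - (x $ 2 * x $ 3 + (x $ 4)\<^sup>2))"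
        using x by (simp add: algebra_simps power2_eq_square)
      with q show "v $ 0 * v $ 1 = v $ 2 * v $ 3 + (v $ 4)\<^sup>2" by (simp add: on_quadric_def)
    qed
  qed
  have "p \<in> times_proj quadric m \<longleftrightarrow> (\<exists>x z. x \<in> carrier_vec 5 - {0\<^sub>v 5} \<and> z \<in> carrier_vec (Suc m) - {0\<^sub>v (Suc m)} \<and>
      (\<forall>v\<in>proj_pt x. v $ 0 * v $ 1 = v $ 2 * v $ 3 + (v $ 4)\<^sup>2) \<and> p = pt [x, z])"
    unfolding times_proj_def quadric_def proj_space_def by (auto 4 4)
  also have "\<dots> \<longleftrightarrow> (\<exists>x z. x \<in> carrier_vec 5 - {0\<^sub>v 5} \<and> z \<in> carrier_vec (Suc m) - {0\<^sub>v (Suc m)} \<and>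
      on_quadric x \<and> p = pt [x, z])"
    using on by blast
  finally show ?thesis by (auto simp: valid_pair)
qed

lemma quadric_times_proj_subset: "times_proj quadric m \<subseteq> mproj [4, m]"
  unfolding subset_iff mem_quadric_times_proj mem_mproj by blast

text \<open>The part of the quadric where \<open>x $ i\<close> is nonzero, for \<open>i < 4\<close>, is a graph over an affine space:
  the coordinate paired with \<open>x $ i\<close> is a polynomial in the other ones. Line segments in that affine
  space lift to curves on the quadric, and every point of the quadric lies in one of these parts.\<close>

lemma quadric_curve:
  fixes x x' :: "'k::field vec"
  assumes x: "x \<in> carrier_vec 5" "x \<noteq> 0\<^sub>v 5" "on_quadric x"
    and x': "x' \<in> carrier_vec 5" "on_quadric x'" "\<And>i. i < 4 \<Longrightarrow> x' $ i \<noteq> 0"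
  shows "\<exists>c a b. (\<forall>t. c t \<in> carrier_vec 5 \<and> on_quadric (c t)) \<and> (\<forall>j\<le>4. is_poly (\<lambda>t. c t $ j)) \<and>
    a \<noteq> 0 \<and> b \<noteq> 0 \<and> c 0 = a \<cdot>\<^sub>v x \<and> c 1 = b \<cdot>\<^sub>v x'"
proof -
  have key: ?thesis
    if i: "i < 4" "x $ i \<noteq> 0" and len: "\<And>t. length (cs t) = 5"
      and quad: "\<And>t. cs t ! 0 * cs t ! 1 = cs t ! 2 * cs t ! 3 + (cs t ! 4)\<^sup>2"
      and poly: "\<And>j. j \<in> {0, 1, 2, 3, 4} \<Longrightarrow> is_poly (\<lambda>t. cs t ! j)"
      and c0: "\<And>j. j \<in> {0, 1, 2, 3, 4} \<Longrightarrow> cs 0 ! j = x $ j / x $ i"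
      and c1: "\<And>j. j \<in> {0, 1, 2, 3, 4} \<Longrightarrow> cs 1 ! j = x' $ j / x' $ i" for i cs
  proof -
    have J: "j \<in> {0, 1, 2, 3, 4}" if "j < 5" for j :: nat using that by auto
    have "vec_of_list (cs 0) = inverse (x $ i) \<cdot>\<^sub>v x"
      using x(1) by (intro vec_of_list_eqI) (auto simp: len c0[OF J] field_simps)
    moreover have "vec_of_list (cs 1) = inverse (x' $ i) \<cdot>\<^sub>v x'"
      using x'(1) by (intro vec_of_list_eqI) (auto simp: len c1[OF J] field_simps)
    moreover have "\<forall>t. vec_of_list (cs t) \<in> carrier_vec 5 \<and> on_quadric (vec_of_list (cs t))"
      by (simp only: on_quadric_def vec_of_list_index quad) (simp add: len carrier_vecI)
    moreover have "\<forall>j\<le>4. is_poly (\<lambda>t. vec_of_list (cs t) $ j)"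
      using poly J by (simp add: vec_of_list_index less_Suc_eq_le)
    ultimately show ?thesis
      using i x'(3)
      by (intro exI[of _ "\<lambda>t. vec_of_list (cs t)"] exI[of _ "inverse (x $ i)"] exI[of _ "inverse (x' $ i)"]) auto
  qed
  have nz: "x' $ 0 \<noteq> 0" "x' $ 1 \<noteq> 0" "x' $ 2 \<noteq> 0" "x' $ 3 \<noteq> 0" using x'(3) by auto
  have q: "x $ 0 * x $ 1 = x $ 2 * x $ 3 + x $ 4 * x $ 4" "x' $ 0 * x' $ 1 = x' $ 2 * x' $ 3 + x' $ 4 * x' $ 4"
    using x(3) x'(2) by (simp_all add: on_quadric_def power2_eq_square)
  define g where "g i j t = (1 - t) * (x $ j / x $ i) + t * (x' $ j / x' $ i)" for i j t
  have g: "is_poly (g i j)" for i j unfolding g_def by (intro is_poly_intros)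
  have pg: "is_poly (\<lambda>t. g i a t * g i b t + g i c t * g i c t)"
    "is_poly (\<lambda>t. g i a t * g i b t - g i c t * g i c t)" for i a b c
    by (intro is_poly_intros g)+
  have g01: "g i j 0 = x $ j / x $ i" "g i j 1 = x' $ j / x' $ i" for i j by (simp_all add: g_def)
  have some_nonzero: "x $ 0 \<noteq> 0 \<or> x $ 1 \<noteq> 0 \<or> x $ 2 \<noteq> 0 \<or> x $ 3 \<noteq> 0"
  proof (rule ccontr)
    assume "\<not> ?thesis"
    then have "x $ j = 0" if "j < 5" for j
      using that q(1) by (auto simp: numeral_eq_Suc less_Suc_eq)
    with x(1,2) show False by (auto simp: vec_eq_iff)
  qed
  have sum: "c / p * (d / p) + e / p * (e / p) = b / p" if "p \<noteq> 0" "p * b = c * d + e * e" for b c d e p :: 'k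
  proof -
    have "c / p * (d / p) + e / p * (e / p) = (p * b) / (p * p)"
      unfolding that(2) by (simp add: add_divide_distrib)
    with that(1) show ?thesis by simp
  qed
  have diff: "c / p * (d / p) - e / p * (e / p) = b / p" if "p \<noteq> 0" "p * b = c * d - e * e" for b c d e p :: 'k
  proof -
    have "c / p * (d / p) - e / p * (e / p) = (p * b) / (p * p)"
      unfolding that(2) by (simp add: diff_divide_distrib)
    with that(1) show ?thesis by simp
  qed
  from some_nonzero consider "x $ 0 \<noteq> 0" | "x $ 1 \<noteq> 0" | "x $ 2 \<noteq> 0" | "x $ 3 \<noteq> 0" by blast
  then show ?thesis
  proof cases
    case 1
    have "g 0 2 0 * g 0 3 0 + g 0 4 0 * g 0 4 0 = x $ 1 / x $ 0"
      unfolding g01 by (rule sum) (use 1 q(1) in \<open>simp_all add: algebra_simps\<close>)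
    moreover have "g 0 2 1 * g 0 3 1 + g 0 4 1 * g 0 4 1 = x' $ 1 / x' $ 0"
      unfolding g01 by (rule sum) (use nz q(2) in \<open>simp_all add: algebra_simps\<close>)
    ultimately show ?thesis
      by (intro key[of 0 "\<lambda>t. [1, g 0 2 t * g 0 3 t + g 0 4 t * g 0 4 t, g 0 2 t, g 0 3 t, g 0 4 t]"])
         (use 1 nz in \<open>auto simp: is_poly_const g pg g01 power2_eq_square\<close>)
  next
    case 2
    have "g 1 2 0 * g 1 3 0 + g 1 4 0 * g 1 4 0 = x $ 0 / x $ 1"
      unfolding g01 by (rule sum) (use 2 q(1) in \<open>simp_all add: algebra_simps\<close>)
    moreover have "g 1 2 1 * g 1 3 1 + g 1 4 1 * g 1 4 1 = x' $ 0 / x' $ 1"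
      unfolding g01 by (rule sum) (use nz q(2) in \<open>simp_all add: algebra_simps\<close>)
    ultimately show ?thesis
      by (intro key[of 1 "\<lambda>t. [g 1 2 t * g 1 3 t + g 1 4 t * g 1 4 t, 1, g 1 2 t, g 1 3 t, g 1 4 t]"])
         (use 2 nz in \<open>auto simp: is_poly_const g pg g01 power2_eq_square\<close>)
  next
    case 3
    have "g 2 0 0 * g 2 1 0 - g 2 4 0 * g 2 4 0 = x $ 3 / x $ 2"
      unfolding g01 by (rule diff) (use 3 q(1) in \<open>simp_all add: algebra_simps\<close>)
    moreover have "g 2 0 1 * g 2 1 1 - g 2 4 1 * g 2 4 1 = x' $ 3 / x' $ 2"
      unfolding g01 by (rule diff) (use nz q(2) in \<open>simp_all add: algebra_simps\<close>)
    ultimately show ?thesis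
      by (intro key[of 2 "\<lambda>t. [g 2 0 t, g 2 1 t, 1, g 2 0 t * g 2 1 t - g 2 4 t * g 2 4 t, g 2 4 t]"])
         (use 3 nz in \<open>auto simp: is_poly_const g pg g01 power2_eq_square\<close>)
  next
    case 4
    have "g 3 0 0 * g 3 1 0 - g 3 4 0 * g 3 4 0 = x $ 2 / x $ 3"
      unfolding g01 by (rule diff) (use 4 q(1) in \<open>simp_all add: algebra_simps\<close>)
    moreover have "g 3 0 1 * g 3 1 1 - g 3 4 1 * g 3 4 1 = x' $ 2 / x' $ 3"
      unfolding g01 by (rule diff) (use nz q(2) in \<open>simp_all add: algebra_simps\<close>)
    ultimately show ?thesis
      by (intro key[of 3 "\<lambda>t. [g 3 0 t, g 3 1 t, g 3 0 t * g 3 1 t - g 3 4 t * g 3 4 t, 1, g 3 4 t]"])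
         (use 4 nz in \<open>auto simp: is_poly_const g pg g01 power2_eq_square\<close>)
  qed
qed

lemma dense_open_quadric_times_proj:
  fixes \<phi> :: "'k::field_char_0 vec list \<Rightarrow> 'k"
  assumes \<phi>: "hom_fun [4, m] d \<phi>"
    and w: "valid [4, m] [x', z']" "on_quadric x'" "\<And>i. i < 4 \<Longrightarrow> x' $ i \<noteq> 0" "\<phi> [x', z'] \<noteq> 0"
  shows "dense_open [4, m] (times_proj quadric m) (times_proj quadric m \<inter> nonvanish [4, m] \<phi>)"
proof (rule dense_open_nonvanish[OF \<phi>])
  show "times_proj quadric m \<subseteq> mproj [4, m]"
    by (rule quadric_times_proj_subset)
  fix vs :: "'k vec list" assume "pt vs \<in> times_proj quadric m"
  then obtain x z where xz: "valid [4, m] [x, z]" "on_quadric x" "pt vs = pt [x, z]"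
    unfolding mem_quadric_times_proj by blast
  have x: "x \<in> carrier_vec 5" "x \<noteq> 0\<^sub>v 5" and z: "z \<in> carrier_vec (Suc m)"
    using xz(1) by (auto simp: valid_pair)
  have x': "x' \<in> carrier_vec 5" and z': "z' \<in> carrier_vec (Suc m)"
    using w(1) by (auto simp: valid_pair)
  obtain c a b where c: "\<And>t. c t \<in> carrier_vec 5 \<and> on_quadric (c t)" "\<And>j. j \<le> 4 \<Longrightarrow> is_poly (\<lambda>t. c t $ j)"
    "a \<noteq> 0" "b \<noteq> 0" "c 0 = a \<cdot>\<^sub>v x" "c 1 = b \<cdot>\<^sub>v x'"
    using quadric_curve[OF x xz(2) x' w(2,3)] by blast
  define C where "C t = [c t, segment (Suc m) z z' t]" for t
  have "curve [4, m] C"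
    using c(1,2) by (auto simp: curve_def C_def segment_simps[OF z z'] is_poly_segment less_Suc_eq)
  moreover have "pt (C 0) = pt vs" "pt (C 1) = pt [x', z']"
    unfolding xz(3) by (simp_all add: C_def segment_simps[OF z z'] c(3-6) proj_pt_smult)
  moreover have "pt [x', z'] \<in> nonvanish [4, m] \<phi>" using w(1,4) unfolding nonvanish_def by blast
  moreover have "pt (C t) \<in> times_proj quadric m" if "valid [4, m] (C t)" for t
    using that c(1) unfolding mem_quadric_times_proj C_def by blast
  ultimately show "\<exists>c t0 t1. curve [4, m] c \<and> pt (c t0) = pt vs \<and> pt (c t1) \<in> nonvanish [4, m] \<phi> \<and>
        (\<forall>t. valid [4, m] (c t) \<longrightarrow> pt (c t) \<in> times_proj quadric m)"
    by (intro exI[of _ C] exI[of _ 0] exI[of _ 1]) auto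
qed

section \<open>Stable linearizability of the quadric\<close>

lemma valid_6: "valid [6] vs \<longleftrightarrow> (\<exists>u. vs = [u] \<and> u \<in> carrier_vec 7 \<and> u \<noteq> 0\<^sub>v 7)"
  by (simp add: valid_single)

lemma valid_4_3: "valid [4, 3] vs \<longleftrightarrow> (\<exists>x z. vs = [x, z] \<and>
    x \<in> carrier_vec 5 \<and> x \<noteq> 0\<^sub>v 5 \<and> z \<in> carrier_vec 4 \<and> z \<noteq> 0\<^sub>v 4)"
  by (simp add: valid_pair)

lemma image_proj_pt:
  assumes "A \<in> carrier_mat n m" "v \<in> carrier_vec m"
  shows "(*\<^sub>v) A ` proj_pt v = proj_pt (A *\<^sub>v v)"
proof -
  have "(*\<^sub>v) A ` proj_pt v = {A *\<^sub>v (c \<cdot>\<^sub>v v) | c. c \<noteq> 0}"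
    unfolding proj_pt_def by blast
  then show ?thesis unfolding mult_mat_vec[OF assms] proj_pt_def .
qed

text \<open>A group element is a rotation, possibly preceded by the reflection.\<close>

lemma from_linear_equivariant:
  fixes \<zeta> \<zeta>' :: "'k::field_char_0"
  assumes roots: "\<zeta> ^ (k + l) = 1" "\<zeta>' \<noteq> 0" "\<zeta> \<noteq> 0" and k: "\<zeta> = \<zeta>' * (\<zeta> ^ k)\<^sup>2"
    and u: "u \<in> carrier_vec 7" and F: "from_linear k l [u] = [x, z]" "x \<in> carrier_vec 5"
  shows "pt (from_linear k l [dihedral_mat 7 6
           ((!) [\<zeta>, inverse \<zeta>, \<zeta>', inverse \<zeta>', inverse (\<zeta> ^ k), \<zeta> ^ k, 1]) (int b, s) *\<^sub>v u]) =
         pt [dihedral_mat 5 4 ((!) [\<zeta>, inverse \<zeta>, \<zeta>', inverse \<zeta>', 1]) (int b, s) *\<^sub>v x, z]"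
proof -
  have rot: "from_linear k l [linear_rot (\<zeta> ^ b) (\<zeta>' ^ b) ((\<zeta> ^ k) ^ b) u'] = [quadric_rot (\<zeta> ^ b) (\<zeta>' ^ b) x', z']"
    if "from_linear k l [u'] = [x', z']" for u' x' z'
  proof (rule from_linear_rot[OF _ _ _ _ _ that])
    show "(\<zeta> ^ k) ^ b = (\<zeta> ^ b) ^ k" by (simp add: mult.commute flip: power_mult)
    show "(\<zeta> ^ b) ^ (k + l) = 1" using roots(1) by (metis mult.commute power_mult power_one)
    have "\<zeta> ^ b = (\<zeta>' * (\<zeta> ^ k)\<^sup>2) ^ b" using k by simp
    then show "\<zeta> ^ b = ((\<zeta> ^ k) ^ b)\<^sup>2 * \<zeta>' ^ b"
      by (simp add: power_mult_distrib ac_simps flip: power_mult)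
  qed (use roots in auto)
  show ?thesis
    unfolding dihedral_mat_linear[OF u] dihedral_mat_quadric[OF F(2)] power_int_of_nat
    using rot[OF F(1)] rot[OF from_linear_flip[OF F(1)]] by (simp add: proj_pt_smult)
qed

text \<open>The linear model is the sum of the two given representations, of the representation \<open>R\<close> with
  weights \<open>\<zeta>\<^sup>-\<^sup>k\<close> and \<open>\<zeta>\<^sup>k\<close>, and of a trivial line; the second factor is a projective three-space.\<close>

lemma quadric_stably_linearizable:
  fixes \<zeta> \<zeta>' :: "'k::field_char_0"
  assumes m: "k < m" "m > 1" and roots: "\<zeta> ^ m = 1" "\<zeta>' ^ m = 1" and k: "\<zeta> = \<zeta>' * (\<zeta> ^ k)\<^sup>2"
    and a: "\<And>\<gamma>. \<gamma> \<in> carrier (dihedral m) \<Longrightarrow>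
      \<rho> \<gamma> = dihedral_mat 5 4 ((!) [\<zeta>, inverse \<zeta>, \<zeta>', inverse \<zeta>', 1]) \<gamma>"
  shows "stably_linearizable (dihedral m) [4] quadric (proj_action \<rho>)"
proof -
  define l where "l = m - k"
  have kl: "k + l = m" using m by (simp add: l_def)
  have nz: "\<zeta> \<noteq> 0" "\<zeta>' \<noteq> 0" using roots m by (auto simp: power_0_left)
  let ?w = "(!) [\<zeta>, inverse \<zeta>, \<zeta>', inverse \<zeta>', inverse (\<zeta> ^ k), \<zeta> ^ k, 1]"
  have root_k: "(\<zeta> ^ k) ^ m = 1" using roots(1) by (metis mult.commute power_mult power_one)
  have seven: "i \<in> {0, 1, 2, 3, 4, 5, 6}" if "i < 7" for i :: nat using that by auto
  interpret dihedral_weights 7 6 m ?w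
  proof
    fix i :: nat assume "i < 7"
    from seven[OF this] show "?w i ^ m = 1" "?w (pair_swap 6 i) = inverse (?w i)"
      using roots root_k by (auto simp: pair_swap_def power_inverse)
  qed (use m in auto)
  let ?\<rho> = "dihedral_mat 7 6 ?w" and ?P = "from_linear_denom k l :: 'k vec list \<Rightarrow> 'k"
    and ?Q = "to_linear_denom k l :: 'k vec list \<Rightarrow> 'k"
    and ?F = "from_linear k l :: 'k vec list \<Rightarrow> 'k vec list" and ?G = "to_linear k l :: 'k vec list \<Rightarrow> 'k vec list"
  have inY: "pt [x, z] \<in> times_proj quadric 3 \<longleftrightarrow> on_quadric x" if v: "valid [4, 3] [x, z]" for x z :: "'k vec"
  proof
    assume "pt [x, z] \<in> times_proj quadric 3"
    then obtain x' z' where xz': "valid [4, 3] [x', z']" "on_quadric x'" "pt [x, z] = pt [x', z']"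
      unfolding mem_quadric_times_proj by blast
    obtain c where "[x, z] = scale c [x', z']" using pt_eqD[OF xz'(3)] by blast
    then have x: "x = c 0 \<cdot>\<^sub>v x'" by (simp add: scale_def)
    have "x' \<in> carrier_vec 5" using xz'(1) by (auto simp: valid_4_3)
    then have "x $ 0 * x $ 1 = (c 0)\<^sup>2 * (x' $ 0 * x' $ 1)"
      "x $ 2 * x $ 3 + (x $ 4)\<^sup>2 = (c 0)\<^sup>2 * (x' $ 2 * x' $ 3 + (x' $ 4)\<^sup>2)"
      by (simp_all add: x algebra_simps power2_eq_square)
    with xz'(2) show "on_quadric x" by (simp add: on_quadric_def)
  next
    assume "on_quadric x"
    with v show "pt [x, z] \<in> times_proj quadric 3" unfolding mem_quadric_times_proj by blast
  qed
  have F: "\<exists>x z. ?F vs = [x, z] \<and> valid [4, 3] [x, z] \<and> on_quadric x \<and> ?Q [x, z] \<noteq> 0 \<and> pt (?G (?F vs)) = pt vs"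
    if vs: "valid [6] vs" "?P vs \<noteq> 0" for vs
  proof -
    obtain u where u: "vs = [u]" "u \<in> carrier_vec 7" using vs(1) unfolding valid_6 by blast
    note * = to_linear_from_linear[OF u(2), of k l]
    have nz: "?P [u] \<noteq> 0" using vs(2) u(1) by simp
    show ?thesis
      using *[OF nz] unfolding u(1) by (auto simp: valid_4_3 on_quadric_def proj_pt_smult)
  qed
  have G: "valid [6] (?G ws) \<and> ?P (?G ws) \<noteq> 0 \<and> pt (?F (?G ws)) = pt ws"
    if ws: "valid [4, 3] ws" "pt ws \<in> times_proj quadric 3" "?Q ws \<noteq> 0" for ws
  proof -
    obtain x z where xz: "ws = [x, z]" "x \<in> carrier_vec 5" "z \<in> carrier_vec 4"
      using ws(1) unfolding valid_4_3 by blast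
    have "on_quadric x" using ws inY xz(1) by blast
    then have q: "x $ 0 * x $ 1 = x $ 2 * x $ 3 + (x $ 4)\<^sup>2" by (simp add: on_quadric_def)
    have nz: "?Q [x, z] \<noteq> 0" using ws(3) xz(1) by simp
    show ?thesis
      using from_linear_to_linear[OF xz(2,3) nz q] unfolding xz(1) by (auto simp: valid_6 proj_pt_smult)
  qed
  \<comment> \<open>A point with \<open>2 * 1 = 1 * 1 + 1\<^sup>2\<close> at which the denominator is \<open>(2 ^ m - 1) * 2 ^ k\<close>,
    nonzero in characteristic zero, and whose first four coordinates are nonzero.\<close>
  define x0 z0 :: "'k vec" where xz0: "x0 = vec_of_list [1, 2, 1, 1, 1]" "z0 = vec_of_list [1, 1, 1, 0]"
  have x0: "x0 $ 0 = 1" "x0 $ 1 = 2" "x0 $ 2 = 1" "x0 $ 3 = 1" "x0 $ 4 = 1"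
    and z0: "z0 $ 0 = 1" "z0 $ 1 = 1" "z0 $ 2 = 1" "z0 $ 3 = 0"
    and car0: "x0 \<in> carrier_vec 5" "z0 \<in> carrier_vec 4"
    by (simp_all add: xz0 vec_of_list_index carrier_vecI del: vec_of_list_Cons)
  have v0: "valid [4, 3] [x0, z0]" using x0(1) z0(1) car0 by (auto simp: valid_4_3)
  have q0: "on_quadric x0" using x0 by (simp add: on_quadric_def)
  have "(2 :: 'k) ^ (k + l) \<noteq> 1"
  proof -
    have "(2 :: nat) ^ (k + l) \<noteq> 1" using m kl by simp
    then have "of_nat (2 ^ (k + l)) \<noteq> (of_nat 1 :: 'k)" unfolding of_nat_eq_iff .
    then show ?thesis by simp
  qed
  then have Q0: "?Q [x0, z0] \<noteq> 0"
    using x0 z0 by (simp add: to_linear_denom_def Let_def)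
  have "dense_open [4, 3] (times_proj quadric 3) (times_proj quadric 3 \<inter> nonvanish [4, 3] ?Q)"
  proof (rule dense_open_quadric_times_proj[OF hom_fun_to_linear_denom v0 q0 _ Q0])
    fix i :: nat assume "i < 4"
    then have "i \<in> {0, 1, 2, 3}" by auto
    with x0 show "x0 $ i \<noteq> 0" by auto
  qed
  moreover have "dense_open [6] (mproj [6]) (mproj [6] \<inter> nonvanish [6] ?P)"
  proof -
    have "valid [6] (?G [x0, z0])" "?P (?G [x0, z0]) \<noteq> 0" using G v0 inY q0 Q0 by blast+
    moreover from this obtain u0 where "?G [x0, z0] = [u0]" unfolding valid_6 by blast
    ultimately show ?thesis using dense_open_proj_space[OF hom_fun_from_linear_denom] by metis
  qed
  moreover have "\<exists>vs'. valid [6] vs' \<and> proj_action ?\<rho> \<gamma> (pt vs) = pt vs' \<and>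
      pt (?F vs') = times_trivial (proj_action \<rho>) \<gamma> (pt (?F vs))"
    if \<gamma>: "\<gamma> \<in> carrier (dihedral m)" and vs: "valid [6] vs" "?P vs \<noteq> 0" for \<gamma> vs
  proof -
    obtain b s where bs: "\<gamma> = (int b, s)"
      using \<gamma> that[of "nat (fst \<gamma>)" "snd \<gamma>"] by (auto simp: dihedral_def)
    obtain u where u: "vs = [u]" "u \<in> carrier_vec 7" using vs(1) unfolding valid_6 by blast
    obtain x z where xz: "?F [u] = [x, z]" "x \<in> carrier_vec 5" using F[OF vs] unfolding u(1) valid_4_3 by blast
    have \<rho>: "?\<rho> \<gamma> \<in> carrier_mat 7 7" by (simp add: bs dihedral_mat_def)
    have R: "\<rho> \<gamma> \<in> carrier_mat 5 5" unfolding a[OF \<gamma>] unfolding bs by (simp add: dihedral_mat_def)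
    \<comment> \<open>The last coordinate is invariant and nonzero, so the image is not the zero vector.\<close>
    have "u $ 6 \<noteq> 0" using vs(2) by (auto simp: u(1) from_linear_denom_def Let_def)
    moreover have "(?\<rho> \<gamma> *\<^sub>v u) $ 6 = u $ 6"
      using u(2) by (simp add: bs dihedral_mat_def monomial_mat_mult_vec pair_swap_def)
    ultimately have "(?\<rho> \<gamma> *\<^sub>v u) $ 6 \<noteq> 0\<^sub>v 7 $ 6" by simp
    then have "?\<rho> \<gamma> *\<^sub>v u \<noteq> 0\<^sub>v 7" by metis
    then have "valid [6] [?\<rho> \<gamma> *\<^sub>v u]"
      using mult_mat_vec_carrier[OF \<rho> u(2)] unfolding valid_6 by blast
    moreover have "proj_action ?\<rho> \<gamma> (pt vs) = pt [?\<rho> \<gamma> *\<^sub>v u]"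
      by (simp add: proj_action_def u(1) image_proj_pt[OF \<rho> u(2)])
    moreover have "times_trivial (proj_action \<rho>) \<gamma> (pt [x, z]) = pt [\<rho> \<gamma> *\<^sub>v x, z]"
      by (simp add: times_trivial_def proj_action_def image_proj_pt[OF R xz(2)])
    moreover have "pt (?F [?\<rho> \<gamma> *\<^sub>v u]) = pt [\<rho> \<gamma> *\<^sub>v x, z]"
      unfolding a[OF \<gamma>] unfolding bs
      by (rule from_linear_equivariant[OF _ nz(2,1) k u(2) xz]) (simp add: kl roots)
    ultimately show ?thesis unfolding u(1) xz(1) by metis
  qed
  moreover have "valid [4, 3] (?F vs) \<and> pt (?F vs) \<in> times_proj quadric 3 \<and> ?Q (?F vs) \<noteq> 0 \<and>
      pt (?G (?F vs)) = pt vs" if vs: "valid [6] vs" "?P vs \<noteq> 0" for vs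
  proof -
    obtain x z where "?F vs = [x, z]" "valid [4, 3] [x, z]" "on_quadric x" "?Q [x, z] \<noteq> 0"
      "pt (?G (?F vs)) = pt vs"
      using F[OF vs] by blast
    then show ?thesis using inY[of x z] by simp
  qed
  moreover have "valid [6] (?G ws) \<and> pt (?G ws) \<in> mproj [6] \<and> ?P (?G ws) \<noteq> 0 \<and> pt (?F (?G ws)) = pt ws"
    if "valid [4, 3] ws" "pt ws \<in> times_proj quadric 3" "?Q ws \<noteq> 0" for ws
    using G[OF that] unfolding mem_mproj by blast
  ultimately have "equivariantly_birational (dihedral m) [6] (mproj [6]) (proj_action ?\<rho>)
      [4, 3] (times_proj quadric 3) (times_trivial (proj_action \<rho>))"
    by (intro equivariantly_birationalI[OF order_refl quadric_times_proj_subset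
          hom_map_from_linear[of k l] hom_map_to_linear[of k l]
          hom_fun_from_linear_denom[of k l] hom_fun_to_linear_denom[of k l]]) blast+
  then show ?thesis
    using dihedral_mat_hom unfolding stably_linearizable_def linearizable_def
    by (intro exI[of _ 3] exI[of _ 6] exI[of _ ?\<rho>]) simp
qed

theorem proposition6p1:
  fixes n :: nat
    and \<zeta> \<zeta>' :: "'k::{alg_closed_field, field_char_0}"
    and \<rho> \<rho>' :: "int \<times> bool \<Rightarrow> 'k mat"
  assumes "odd n"
    and "primitive_root_of_unity (4 * n) \<zeta>"
    and "primitive_root_of_unity (4 * n) \<zeta>'"
    and "faithful_standard_rep (4 * n) \<zeta> \<rho>"
    and "faithful_standard_rep (4 * n) \<zeta>' \<rho>'"
  shows "stably_linearizable (dihedral (4 * n)) [4] (quadric :: 'k vec set list set)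
           (proj_action (\<lambda>\<gamma>. diag_block_mat [\<rho> \<gamma>, \<rho>' \<gamma>, 1\<^sub>m 1]))"
proof -
  have n: "n > 0" using assms(1) by (rule odd_pos)
  have m: "4 * n = 2 * (2 * n)" by simp
  have roots: "\<zeta> ^ (4 * n) = 1" "\<zeta>' ^ (4 * n) = 1"
    using assms(2,3) by (auto simp: primitive_root_of_unity_def)
  obtain k where k: "k < 2 * n" "\<zeta> = \<zeta>' * (\<zeta> ^ k)\<^sup>2"
    using half_exponent[OF assms(2)[unfolded m] assms(3)[unfolded m]] n by auto
  show ?thesis
  proof (rule quadric_stably_linearizable[OF _ _ roots k(2)])
    fix \<gamma> assume "\<gamma> \<in> carrier (dihedral (4 * n))"
    then have "\<rho> \<gamma> = dihedral_mat 2 2 ((!) [\<zeta>, inverse \<zeta>]) \<gamma>" "\<rho>' \<gamma> = dihedral_mat 2 2 ((!) [\<zeta>', inverse \<zeta>']) \<gamma>"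
      using faithful_standard_rep_eq[OF assms(4) _ roots(1)] faithful_standard_rep_eq[OF assms(5) _ roots(2)] n
      by auto
    then show "diag_block_mat [\<rho> \<gamma>, \<rho>' \<gamma>, 1\<^sub>m 1] = dihedral_mat 5 4 ((!) [\<zeta>, inverse \<zeta>, \<zeta>', inverse \<zeta>', 1]) \<gamma>"
      by (simp only: diag_block_standard_eq)
  qed (use k n in auto)
qed

end
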